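(* Assume (A1). Then, for every $(z,T)\in\mathbb{T}^n\times(0,\infty)$ and every $\varepsilon\in(0,1)$, $$u^\varepsilon(z,T)=\int_{\mathbb{T}^n} g(x)\,\sigma^{\varepsilon,z}(x,0)\,dx+\int_0^T\int_{\mathbb{T}^n\times\mathbb{R}^n}\big(D_pH(x,p)\cdot p-H(x,p)\big)\,d\nu^{\varepsilon,z}(x,p,t)\,dt$$ $$=\int_{\mathbb{T}^n} g(x)\,\sigma^{\varepsilon,z}(x,0)\,dx+\int_{\mathbb{T}^n\times\mathbb{R}^n\times[0,T]}\big(D_pH(x,p)\cdot p-H(x,p)\big)\,d\mu^{\varepsilon,z}(x,p,t).$$ Moreover, let $\{\varepsilon_k\}$ be a sequence converging to $0$ such that $\sigma^{\varepsilon_k,z}(x,0)\,dx$ converges to $d\sigma^z(x)$ and $\mu^{\varepsilon_k,z}$ converges to $\mu^z$, both weakly in the sense of measures. Then $$u(z,T)=\int_{\mathbb{T}^n} g(x)\,d\sigma^z(x)+\int_{\mathbb{T}^n\times\mathbb{R}^n\times[0,T]}\big(D_pH(x,p)\cdot p-H(x,p)\big)\,d\mu^z(x,p,t).$$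
   Context: $\mathbb{T}^n=\mathbb{R}^n/\mathbb{Z}^n$; $H\in C^2(\mathbb{T}^n\times\mathbb{R}^n)$ and $g\in C^2(\mathbb{T}^n)$ are given. (A1): $\displaystyle\lim_{|p|\to\infty}\min_{x\in\mathbb{T}^n}\Big(\tfrac12 H(x,p)^2+D_xH(x,p)\cdot p\Big)=+\infty.$ $u$ is the viscosity solution of $u_t+H(x,Du)=0$ in $\mathbb{T}^n\times(0,\infty)$, $u(x,0)=g(x)$ on $\mathbb{T}^n$. For $\varepsilon\in(0,1)$, $u^\varepsilon$ is the solution of $u^\varepsilon_t+H(x,Du^\varepsilon)=\varepsilon\Delta u^\varepsilon$ in $\mathbb{T}^n\times(0,\infty)$, $u^\varepsilon(x,0)=g(x)$ on $\mathbb{T}^n$. Under (A1) there is a constant $C>0$, depending only on $\|g\|_{C^2(\mathbb{T}^n)}$, $H$ and $n$, such that $\|u^\varepsilon_t\|_{L^\infty}+\|Du^\varepsilon\|_{L^\infty}\le C$ and $\|u_t\|_{L^\infty}+\|Du\|_{L^\infty}\le C$ on $\mathbb{T}^n\times[0,\infty)$ for all $\varepsilon\in(0,1)$, and $u^\varepsilon\to u$ locally uniformly on $\mathbb{T}^n\times[0,\infty)$ as $\varepsilon\to0$. Fix $(z,T)\in\mathbb{T}^n\times(0,\infty)$. $\sigma^{\varepsilon,z}$ (depending also on $T$) is the solution of the adjoint problem $-\sigma_t-\operatorname{div}(D_pH(x,Du^\varepsilon)\sigma)=\varepsilon\Delta\sigma$ in $\mathbb{T}^n\times(0,T)$, $\sigma(\cdot,T)=\delta_z$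 (Dirac mass at $z$). One has $\sigma^{\varepsilon,z}\ge0$ and $\int_{\mathbb{T}^n}\sigma^{\varepsilon,z}(x,t)\,dx=1$ for $t\in[0,T)$. For each $t$, $\nu^{\varepsilon,z}(\cdot,\cdot,t)$ is the probability measure on $\mathbb{T}^n\times\overline B(0,C)$ with $\int_{\mathbb{T}^n\times\mathbb{R}^n}\psi(x,p)\,d\nu^{\varepsilon,z}(x,p,t)=\int_{\mathbb{T}^n}\psi(x,Du^\varepsilon(x,t))\sigma^{\varepsilon,z}(x,t)\,dx$ for all $\psi\in C(\mathbb{T}^n\times\mathbb{R}^n)$, and $\mu^{\varepsilon,z}$ is the nonnegative Radon measure on $\mathbb{T}^n\times\overline B(0,C)\times[0,T]$ given by $d\mu^{\varepsilon,z}(x,p,t)=d\nu^{\varepsilon,z}(x,p,t)\,dt$ (total mass $T$). The weak limits $\sigma^z$ and $\mu^z$ are Radon measures on $\mathbb{T}^n$ and on $\mathbb{T}^n\times\overline B(0,C)\times[0,T]$ respectively. *)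

theory Defs
  imports "HOL-Probability.Probability"
begin

text \<open>
  Functions on the torus \<open>\<real>\<^sup>n/\<int>\<^sup>n\<close> are represented by their \<open>\<int>\<^sup>n\<close>-periodic lifts to \<open>\<real>\<^sup>n\<close>, and
  Borel measures on the torus by Borel measures on \<open>\<real>\<^sup>n\<close> concentrated on the half-open unit
  cell, which the quotient map sends bijectively and bimeasurably onto the torus.  The topology of
  the torus enters only through the test functions, which are continuous \<^emph>\<open>and\<close> periodic.
\<close>

definition periodic :: "(real^'n \<Rightarrow> 'b) \<Rightarrow> bool" where
  "periodic f \<longleftrightarrow> (\<forall>x k. (\<forall>i. k $ i \<in> \<int>) \<longrightarrow> f (x + k) = f x)"

definition unit_cell :: "(real^'n) set" where
  "unit_cell = {x. \<forall>i. 0 \<le> x $ i \<and> x $ i < 1}"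

definition finite_borel_measure_on :: "'a::topological_space set \<Rightarrow> 'a measure \<Rightarrow> bool" where
  "finite_borel_measure_on K M \<longleftrightarrow> sets M = sets borel \<and> finite_measure M \<and> (AE y in M. y \<in> K)"

definition grad :: "(real^'n \<Rightarrow> real) \<Rightarrow> real^'n \<Rightarrow> real^'n" where
  "grad f x = (THE D. GDERIV f x :> D)"

definition divergence :: "(real^'n \<Rightarrow> real^'n) \<Rightarrow> real^'n \<Rightarrow> real" where
  "divergence F x = (\<Sum>i\<in>UNIV. frechet_derivative F (at x) (axis i 1) $ i)"

definition laplacian :: "(real^'n \<Rightarrow> real) \<Rightarrow> real^'n \<Rightarrow> real" where
  "laplacian f x = divergence (grad f) x"

definition C1_on :: "'a::euclidean_space set \<Rightarrow> ('a \<Rightarrow> real) \<Rightarrow> bool" where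
  "C1_on S f \<longleftrightarrow>
     (\<exists>f' :: 'a \<Rightarrow> 'a \<Rightarrow>\<^sub>L real.
        (\<forall>x\<in>S. (f has_derivative blinfun_apply (f' x)) (at x)) \<and> continuous_on S f')"

definition C2_on :: "'a::euclidean_space set \<Rightarrow> ('a \<Rightarrow> real) \<Rightarrow> bool" where
  "C2_on S f \<longleftrightarrow>
     (\<exists>(f' :: 'a \<Rightarrow> 'a \<Rightarrow>\<^sub>L real) (f'' :: 'a \<Rightarrow> 'a \<Rightarrow>\<^sub>L 'a \<Rightarrow>\<^sub>L real).
        (\<forall>x\<in>S. (f has_derivative blinfun_apply (f' x)) (at x)) \<and>
        (\<forall>x\<in>S. (f' has_derivative blinfun_apply (f'' x)) (at x)) \<and>
        continuous_on S f'')"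

text \<open>\<open>C21_on I f\<close>: \<open>f(x,t)\<close> is of class \<open>C\<^sup>2\<close> in \<open>x\<close> and \<open>C\<^sup>1\<close> in \<open>t\<close> on \<open>\<real>\<^sup>n \<times> I\<close> (\<open>I\<close> open), all these
  derivatives being jointly continuous.\<close>

definition C21_on :: "real set \<Rightarrow> (real^'n \<Rightarrow> real \<Rightarrow> real) \<Rightarrow> bool" where
  "C21_on I f \<longleftrightarrow>
     (\<exists>(D1 :: real^'n \<Rightarrow> real \<Rightarrow> ((real^'n) \<Rightarrow>\<^sub>L real))
       (D2 :: real^'n \<Rightarrow> real \<Rightarrow> ((real^'n) \<Rightarrow>\<^sub>L (real^'n) \<Rightarrow>\<^sub>L real))
       (Dt :: real^'n \<Rightarrow> real \<Rightarrow> real).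
        (\<forall>x. \<forall>t\<in>I.
           ((\<lambda>y. f y t) has_derivative blinfun_apply (D1 x t)) (at x) \<and>
           ((\<lambda>y. D1 y t) has_derivative blinfun_apply (D2 x t)) (at x) \<and>
           (f x has_real_derivative Dt x t) (at t)) \<and>
        continuous_on (UNIV \<times> I) (\<lambda>(x,t). f x t) \<and>
        continuous_on (UNIV \<times> I) (\<lambda>(x,t). D1 x t) \<and>
        continuous_on (UNIV \<times> I) (\<lambda>(x,t). D2 x t) \<and>
        continuous_on (UNIV \<times> I) (\<lambda>(x,t). Dt x t))"

text \<open>Viscosity solutions of \<open>u\<^sub>t + H(x,Du) = 0\<close>, \<open>u(\<cdot>,0) = g\<close> (Crandall--Evans--Lions).  Since the
  definition is local, test functions need not be periodic.\<close>

definition viscosity_solution ::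
  "(real^'n \<Rightarrow> real^'n \<Rightarrow> real) \<Rightarrow> (real^'n \<Rightarrow> real) \<Rightarrow> (real^'n \<Rightarrow> real \<Rightarrow> real) \<Rightarrow> bool" where
  "viscosity_solution H g u \<longleftrightarrow>
     (\<forall>t\<ge>0. periodic (\<lambda>x. u x t)) \<and>
     continuous_on (UNIV \<times> {0..}) (\<lambda>(x,t). u x t) \<and>
     (\<forall>x. u x 0 = g x) \<and>
     (\<forall>\<phi> x t. C1_on (UNIV \<times> {0<..}) (\<lambda>(y,s). \<phi> y s) \<and> t > 0 \<longrightarrow>
        ((\<forall>\<^sub>F (y,s) in nhds (x,t). u y s - \<phi> y s \<le> u x t - \<phi> x t) \<longrightarrow>
           deriv (\<phi> x) t + H x (grad (\<lambda>y. \<phi> y t) x) \<le> 0) \<and>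
        ((\<forall>\<^sub>F (y,s) in nhds (x,t). u y s - \<phi> y s \<ge> u x t - \<phi> x t) \<longrightarrow>
           deriv (\<phi> x) t + H x (grad (\<lambda>y. \<phi> y t) x) \<ge> 0))"

definition viscous_solution ::
  "real \<Rightarrow> (real^'n \<Rightarrow> real^'n \<Rightarrow> real) \<Rightarrow> (real^'n \<Rightarrow> real) \<Rightarrow> (real^'n \<Rightarrow> real \<Rightarrow> real) \<Rightarrow> bool" where
  "viscous_solution \<epsilon> H g v \<longleftrightarrow>
     (\<forall>t\<ge>0. periodic (\<lambda>x. v x t)) \<and>
     continuous_on (UNIV \<times> {0..}) (\<lambda>(x,t). v x t) \<and>
     C21_on {0<..} v \<and>
     (\<forall>x. v x 0 = g x) \<and>
     (\<forall>x. \<forall>t>0. deriv (v x) t + H x (grad (\<lambda>y. v y t) x) = \<epsilon> * laplacian (\<lambda>y. v y t) x)"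

text \<open>The adjoint problem \<open>-\<sigma>\<^sub>t - div(D\<^sub>pH(x,Dv) \<sigma>) = \<epsilon> \<Delta>\<sigma>\<close> on \<open>(0,T)\<close>, \<open>\<sigma>(\<cdot>,T) = \<delta>\<^sub>z\<close>.  As \<open>H\<close> is only
  \<open>C\<^sup>2\<close>, the divergence of the drift is merely continuous and \<open>\<sigma>\<close> need not have classical second
  derivatives; the equation is therefore understood in the sense of distributions on
  \<open>\<real>\<^sup>n/\<int>\<^sup>n \<times> (0,T)\<close>, for a function \<open>\<sigma>\<close> that is continuous up to \<open>t = 0\<close>.  (A classical solution
  satisfies this by integration by parts.)  The terminal condition is weak convergence of the
  measures \<open>\<sigma>(x,t) dx\<close> to the Dirac mass at \<open>z\<close> as \<open>t\<close> increases to \<open>T\<close>.\<close>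

definition adjoint_solution ::
  "real \<Rightarrow> (real^'n \<Rightarrow> real^'n \<Rightarrow> real) \<Rightarrow> (real^'n \<Rightarrow> real \<Rightarrow> real) \<Rightarrow> real^'n \<Rightarrow> real \<Rightarrow>
   (real^'n \<Rightarrow> real \<Rightarrow> real) \<Rightarrow> bool" where
  "adjoint_solution \<epsilon> H v z T \<sigma> \<longleftrightarrow>
     (\<forall>t\<in>{0..<T}. periodic (\<lambda>x. \<sigma> x t)) \<and>
     continuous_on (UNIV \<times> {0..<T}) (\<lambda>(x,t). \<sigma> x t) \<and>
     (\<forall>\<phi>. C21_on {0<..<T} \<phi> \<and> (\<forall>t\<in>{0<..<T}. periodic (\<lambda>x. \<phi> x t)) \<and>
          (\<exists>a b. 0 < a \<and> a < b \<and> b < T \<and> (\<forall>x t. t \<notin> {a..b} \<longrightarrow> \<phi> x t = 0)) \<longrightarrow>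
        (LINT t:{0<..<T}|lborel. LINT x:unit_cell|lborel.
           \<sigma> x t * (deriv (\<phi> x) t
                    + grad (H x) (grad (\<lambda>y. v y t) x) \<bullet> grad (\<lambda>y. \<phi> y t) x
                    - \<epsilon> * laplacian (\<lambda>y. \<phi> y t) x)) = 0) \<and>
     (\<forall>\<phi>. continuous_on UNIV \<phi> \<and> periodic \<phi> \<longrightarrow>
        ((\<lambda>t. LINT x:unit_cell|lborel. \<phi> x * \<sigma> x t) \<longlongrightarrow> \<phi> z) (at_left T))"

text \<open>\<open>nu_measure C w s N\<close>: with \<open>w = Du\<^sup>\<epsilon>(\<cdot>,t)\<close> and \<open>s = \<sigma>\<^sup>\<epsilon>(\<cdot>,t)\<close>, \<open>N\<close> is the probability measure
  \<open>\<nu>\<^sup>\<epsilon>(\<cdot>,\<cdot>,t)\<close>.\<close>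

definition nu_measure ::
  "real \<Rightarrow> (real^'n \<Rightarrow> real^'n) \<Rightarrow> (real^'n \<Rightarrow> real) \<Rightarrow> ((real^'n) \<times> (real^'n)) measure \<Rightarrow> bool" where
  "nu_measure C w s N \<longleftrightarrow>
     prob_space N \<and> finite_borel_measure_on (unit_cell \<times> cball 0 C) N \<and>
     (\<forall>\<psi>. continuous_on UNIV (\<lambda>(x,p). \<psi> x p) \<and> (\<forall>p. periodic (\<lambda>x. \<psi> x p)) \<longrightarrow>
        (LINT (x,p)|N. \<psi> x p) = (LINT x:unit_cell|lborel. \<psi> x (w x) * s x))"

text \<open>\<open>mu_measure C T \<nu> M\<close>: \<open>dM(x,p,t) = d\<nu>\<^sub>t(x,p) dt\<close> on \<open>0 \<le> t \<le> T\<close>.\<close>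

definition mu_measure ::
  "real \<Rightarrow> real \<Rightarrow> (real \<Rightarrow> ((real^'n) \<times> (real^'n)) measure) \<Rightarrow>
   ((real^'n) \<times> (real^'n) \<times> real) measure \<Rightarrow> bool" where
  "mu_measure C T \<nu> M \<longleftrightarrow>
     finite_borel_measure_on (unit_cell \<times> cball 0 C \<times> {0..T}) M \<and>
     (\<forall>A\<in>sets borel.
        emeasure M A = (\<integral>\<^sup>+t\<in>{0..T}. emeasure (\<nu> t) {(x,p). (x,p,t) \<in> A} \<partial>lborel))"

end

theory Submission
  imports Defs
begin

text \<open>
  The representation formula is a duality pairing.  Put \<open>A(t) = \<integral> u\<^sup>\<epsilon>(x,t) \<sigma>(x,t) dx\<close>.  The adjoint
  equation tested with \<open>\<eta>(t) u\<^sup>\<epsilon>(x,t)\<close>, where \<open>\<eta>\<close> depends on time alone, turns into an identity in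
  time: since \<open>u\<^sup>\<epsilon>\<^sub>t - \<epsilon> \<Delta>u\<^sup>\<epsilon> = -H(x,Du\<^sup>\<epsilon>)\<close>, the second derivatives cancel and
  \<open>\<integral> \<eta>' A + \<eta> B dt = 0\<close> with \<open>B(t) = \<integral> (D\<^sub>pH \<bullet> p - H) d\<nu>\<^sub>t\<close>.  A du Bois-Reymond argument gives
  \<open>A' = B\<close> on \<open>(0,T)\<close> (\<open>adjoint_balance\<close>).  Now integrate over \<open>(0,T)\<close>: \<open>A\<close> tends to
  \<open>\<integral> g \<sigma>(x,0) dx\<close> as \<open>t \<rightarrow> 0\<close> by continuity, and to \<open>u\<^sup>\<epsilon>(z,T)\<close> as \<open>t \<rightarrow> T\<close>, because \<open>\<sigma>(x,t) dx\<close> has mass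
  one and converges to the Dirac mass while \<open>u\<^sup>\<epsilon>\<close> is Lipschitz in time uniformly in \<open>x\<close>
  (\<open>duality_representation\<close>).

  The version with \<open>\<mu>\<close> needs Fubini for \<open>d\<mu> = d\<nu>\<^sub>t dt\<close>, but measurability of \<open>t \<mapsto> \<nu>\<^sub>t(A)\<close> is not
  given, so that the time integral defining \<open>\<mu>\<close> is a priori only a lower integral.  Lower integrals
  are superadditive, which yields \<open>\<integral> F d\<mu> \<le> \<integral>\<integral> F d\<nu>\<^sub>t dt\<close> for every Borel \<open>F \<ge> 0\<close>; for a bounded
  integrand \<open>f\<close>, applying this to \<open>b + f\<close> and to \<open>b - f\<close> gives equality (\<open>integral_eq_iterated\<close>).

  In the limit, the two integrals converge by weak convergence of measures, since \<open>g\<close> and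
  \<open>D\<^sub>pH \<bullet> p - H\<close> are continuous and periodic.  What remains is \<open>u\<^sup>\<epsilon>(z,T) \<rightarrow> u(z,T)\<close>, which follows from
  the Crandall--Lions rate \<open>|u - u\<^sup>\<epsilon>| \<le> K \<surd>\<epsilon>\<close> (\<open>vanishing_viscosity_estimate\<close>).  Doubling the space
  variable with penalty \<open>|x - y|\<^sup>2 / (2\<delta>)\<close>, at a maximum point \<open>\<Delta>u\<^sup>\<epsilon>\<close> is bounded by \<open>n/\<delta>\<close> on the side that matters and
  \<open>|x - y|\<close> by \<open>C \<delta>\<close>; the resulting error \<open>\<epsilon> n/\<delta> + L C \<delta>\<close> is balanced by \<open>\<delta> = \<surd>\<epsilon>\<close>.
\<close>

section \<open>Gradients and Laplacians\<close>

lemma grad_eqI: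
  fixes f :: "real^'n \<Rightarrow> real"
  assumes "(f has_derivative (\<lambda>h. h \<bullet> D)) (at x)"
  shows "grad f x = D"
  unfolding grad_def
proof (rule the_equality)
  show "D' = D" if "GDERIV f x :> D'" for D'
  proof -
    have "(\<lambda>h. h \<bullet> D') = (\<lambda>h. h \<bullet> D)"
      using that assms unfolding gderiv_def by (rule has_derivative_unique)
    then show ?thesis by (metis vector_eq_ldot)
  qed
qed (use assms in \<open>simp add: gderiv_def\<close>)

lemma linear_eq_inner_axis:
  fixes f :: "real^'n \<Rightarrow> real"
  assumes "linear f"
  shows "f h = h \<bullet> (\<chi> i. f (axis i 1))"
proof -
  have "f h = f (\<Sum>i\<in>UNIV. h $ i *\<^sub>R axis i 1)"
    using basis_expansion[of h] by (simp add: scalar_mult_eq_scaleR)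
  also have "\<dots> = (\<Sum>i\<in>UNIV. h $ i * f (axis i 1))"
    by (simp add: linear_sum[OF assms] linear_cmul[OF assms])
  finally show ?thesis by (simp add: inner_vec_def)
qed

lemma has_derivative_imp_grad:
  fixes f :: "real^'n \<Rightarrow> real"
  assumes "(f has_derivative f') (at x)"
  shows "grad f x = (\<chi> i. f' (axis i 1))" "f' h = h \<bullet> grad f x"
proof -
  have *: "f' h = h \<bullet> (\<chi> i. f' (axis i 1))" for h
    using assms by (intro linear_eq_inner_axis has_derivative_linear)
  show 1: "grad f x = (\<chi> i. f' (axis i 1))"
    by (rule grad_eqI) (use assms * in \<open>metis (no_types, lifting) ext\<close>)
  show "f' h = h \<bullet> grad f x" unfolding 1 by (rule *)
qed

lemma laplacian_eq:
  fixes f :: "real^'n \<Rightarrow> real"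
    and D1 :: "real^'n \<Rightarrow> (real^'n) \<Rightarrow>\<^sub>L real" and D2 :: "(real^'n) \<Rightarrow>\<^sub>L (real^'n) \<Rightarrow>\<^sub>L real"
  assumes D1: "\<And>y. (f has_derivative D1 y) (at y)"
    and D2: "(D1 has_derivative D2) (at x)"
  shows "laplacian f x = (\<Sum>i\<in>UNIV. D2 (axis i 1) (axis i 1))"
proof -
  have "grad f = (\<lambda>y. \<Sum>i\<in>UNIV. D1 y (axis i 1) *\<^sub>R axis i 1)"
  proof
    fix y
    have "grad f y = (\<chi> i. D1 y (axis i 1))" by (rule has_derivative_imp_grad[OF D1])
    also have "\<dots> = (\<Sum>i\<in>UNIV. D1 y (axis i 1) *\<^sub>R axis i 1)"
      using basis_expansion[of "\<chi> i. D1 y (axis i 1)"] by (simp add: scalar_mult_eq_scaleR)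
    finally show "grad f y = (\<Sum>i\<in>UNIV. D1 y (axis i 1) *\<^sub>R axis i 1)" .
  qed
  moreover have "((\<lambda>y. \<Sum>i\<in>UNIV. D1 y (axis i 1) *\<^sub>R axis i (1::real)) has_derivative
      (\<lambda>h. \<Sum>i\<in>UNIV. D2 h (axis i 1) *\<^sub>R axis i 1)) (at x)"
    by (intro has_derivative_sum has_derivative_scaleR_left
        bounded_linear.has_derivative[OF blinfun.bounded_linear_left] D2)
  ultimately have "frechet_derivative (grad f) (at x) =
      (\<lambda>h. \<Sum>i\<in>UNIV. D2 h (axis i 1) *\<^sub>R axis i 1)"
    by (simp add: frechet_derivative_at[symmetric])
  then show ?thesis
    by (simp add: laplacian_def divergence_def axis_def if_distrib cong: if_cong)
qed

lemma has_derivative_periodic_shift: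
  fixes f :: "real^'n \<Rightarrow> real"
  assumes "periodic f" "\<And>i. k $ i \<in> \<int>" "(f has_derivative f') (at x)"
  shows "(f has_derivative f') (at (x + k))"
proof -
  have "((\<lambda>y. f (y - k)) has_derivative f') (at (x + k))"
    by (rule has_derivative_compose[of "\<lambda>y. y - k" "\<lambda>h. h" "x + k" UNIV f f'])
      (use assms(3) in \<open>auto intro!: derivative_eq_intros\<close>)
  moreover have "f (y - k) = f y" for y
    using assms(1,2) unfolding periodic_def by (metis diff_add_cancel)
  ultimately show ?thesis by simp
qed

lemma C2_on_imp_C1:
  assumes "C2_on UNIV f"
  obtains f' where "\<And>x. (f has_derivative blinfun_apply (f' x)) (at x)" "continuous_on UNIV f'"
proof -
  obtain f' f'' where f: "\<And>x. (f has_derivative blinfun_apply (f' x)) (at x)"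
      "\<And>x. (f' has_derivative blinfun_apply (f'' x)) (at x)"
    using assms unfolding C2_on_def by auto
  have "continuous_on UNIV f'"
    by (intro continuous_at_imp_continuous_on ballI has_derivative_continuous[OF f(2)])
  with f(1) show thesis by (rule that)
qed

lemma continuous_on_momentum_grad:
  fixes H :: "real^'n \<Rightarrow> real^'n \<Rightarrow> real"
  assumes "C2_on UNIV (\<lambda>(x,p). H x p)"
  shows "continuous_on UNIV (\<lambda>(x,p). H x p)" "continuous_on UNIV (\<lambda>(x,p). grad (H x) p)"
proof -
  obtain f' where f: "\<And>y. ((\<lambda>(x,p). H x p) has_derivative blinfun_apply (f' y)) (at y)"
      "continuous_on UNIV f'"
    using C2_on_imp_C1[OF assms] by blast
  show "continuous_on UNIV (\<lambda>(x,p). H x p)"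
    by (intro continuous_at_imp_continuous_on ballI has_derivative_continuous[OF f(1)])
  have "(\<lambda>(x,p). grad (H x) p) = (\<lambda>y. \<chi> i. f' y (0, axis i 1))"
  proof (clarify intro!: ext)
    fix x p :: "real^'n"
    have "((\<lambda>q. (\<lambda>(x,p). H x p) (x, q)) has_derivative (\<lambda>k. f' (x,p) (0, k))) (at p)"
      by (rule has_derivative_compose[OF _ f(1)]) (auto intro!: derivative_eq_intros)
    then show "grad (H x) p = (\<chi> i. f' (x,p) (0, axis i 1))"
      by (intro has_derivative_imp_grad) simp
  qed
  moreover have "continuous_on UNIV (\<lambda>y. \<chi> i. f' y (0, axis i 1))"
    by (intro continuous_intros f(2))
  ultimately show "continuous_on UNIV (\<lambda>(x,p). grad (H x) p)" by simp
qed

text \<open>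
  Besides the derivatives hidden in the definition, this records how the gradient and the
  Laplacian, which are defined by choice operators, are read off from them.
\<close>

lemma C21_on_cases:
  fixes v :: "real^'n \<Rightarrow> real \<Rightarrow> real"
  assumes "C21_on I v"
  obtains D1 :: "real^'n \<Rightarrow> real \<Rightarrow> (real^'n) \<Rightarrow>\<^sub>L real"
    and D2 :: "real^'n \<Rightarrow> real \<Rightarrow> (real^'n) \<Rightarrow>\<^sub>L (real^'n) \<Rightarrow>\<^sub>L real"
    and Dt :: "real^'n \<Rightarrow> real \<Rightarrow> real"
  where "\<And>x t. t \<in> I \<Longrightarrow> ((\<lambda>y. v y t) has_derivative D1 x t) (at x)"
    "\<And>x t. t \<in> I \<Longrightarrow> ((\<lambda>y. D1 y t) has_derivative D2 x t) (at x)"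
    "\<And>x t. t \<in> I \<Longrightarrow> (v x has_real_derivative Dt x t) (at t)"
    "continuous_on (UNIV \<times> I) (\<lambda>(x,t). v x t)" "continuous_on (UNIV \<times> I) (\<lambda>(x,t). D1 x t)"
    "continuous_on (UNIV \<times> I) (\<lambda>(x,t). D2 x t)" "continuous_on (UNIV \<times> I) (\<lambda>(x,t). Dt x t)"
    "\<And>x t. t \<in> I \<Longrightarrow> grad (\<lambda>y. v y t) x = (\<chi> i. D1 x t (axis i 1))"
    "\<And>x t. t \<in> I \<Longrightarrow> laplacian (\<lambda>y. v y t) x = (\<Sum>i\<in>UNIV. D2 x t (axis i 1) (axis i 1))"
proof -
  obtain D1 :: "real^'n \<Rightarrow> real \<Rightarrow> (real^'n) \<Rightarrow>\<^sub>L real"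
    and D2 :: "real^'n \<Rightarrow> real \<Rightarrow> (real^'n) \<Rightarrow>\<^sub>L (real^'n) \<Rightarrow>\<^sub>L real"
    and Dt :: "real^'n \<Rightarrow> real \<Rightarrow> real"
    where D: "\<forall>x. \<forall>t\<in>I. ((\<lambda>y. v y t) has_derivative D1 x t) (at x) \<and>
        ((\<lambda>y. D1 y t) has_derivative D2 x t) (at x) \<and> (v x has_real_derivative Dt x t) (at t)"
    and cont: "continuous_on (UNIV \<times> I) (\<lambda>(x,t). v x t)" "continuous_on (UNIV \<times> I) (\<lambda>(x,t). D1 x t)"
      "continuous_on (UNIV \<times> I) (\<lambda>(x,t). D2 x t)" "continuous_on (UNIV \<times> I) (\<lambda>(x,t). Dt x t)"
    using assms unfolding C21_on_def by blast
  have d: "((\<lambda>y. v y t) has_derivative D1 x t) (at x)" "((\<lambda>y. D1 y t) has_derivative D2 x t) (at x)"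
    "(v x has_real_derivative Dt x t) (at t)" if "t \<in> I" for x t
    using D that by auto
  show thesis
    by (rule that[OF d cont])
      (simp_all add: has_derivative_imp_grad(1)[OF d(1)] laplacian_eq[OF d(1,2)])
qed

lemma continuous_on_spatial_grad:
  fixes v :: "real^'n \<Rightarrow> real \<Rightarrow> real"
  assumes "C21_on I v"
  shows "continuous_on (UNIV \<times> I) (\<lambda>(x,t). grad (\<lambda>y. v y t) x)"
proof (rule C21_on_cases[OF assms])
  fix D1 :: "real^'n \<Rightarrow> real \<Rightarrow> (real^'n) \<Rightarrow>\<^sub>L real"
  assume D1: "continuous_on (UNIV \<times> I) (\<lambda>(x,t). D1 x t)"
    and g: "\<And>x t. t \<in> I \<Longrightarrow> grad (\<lambda>y. v y t) x = (\<chi> i. D1 x t (axis i 1))"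
  have "continuous_on (UNIV \<times> I) (\<lambda>(x,t). \<chi> i. D1 x t (axis i 1))"
    using D1 unfolding split_beta by (intro continuous_intros)
  then show ?thesis
    by (rule continuous_on_eq) (auto simp: g)
qed

text \<open>
  Products \<open>\<eta>(t) v(x,t)\<close> are the test functions for the adjoint equation; with constant \<open>\<eta> = -1\<close>
  the lemma also describes the derivatives of \<open>-v\<close>.
\<close>

lemma C21_on_time_mult:
  fixes v :: "real^'n \<Rightarrow> real \<Rightarrow> real"
  assumes v: "C21_on I v" and \<eta>: "\<And>t. (\<eta> has_real_derivative \<eta>' t) (at t)" "continuous_on UNIV \<eta>'"
  shows "C21_on I (\<lambda>x t. \<eta> t * v x t)"
    and "t \<in> I \<Longrightarrow> deriv (\<lambda>t. \<eta> t * v x t) t = \<eta>' t * v x t + \<eta> t * deriv (v x) t"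
    and "t \<in> I \<Longrightarrow> grad (\<lambda>y. \<eta> t * v y t) x = \<eta> t *\<^sub>R grad (\<lambda>y. v y t) x"
    and "t \<in> I \<Longrightarrow> laplacian (\<lambda>y. \<eta> t * v y t) x = \<eta> t * laplacian (\<lambda>y. v y t) x"
proof -
  obtain D1 :: "real^'n \<Rightarrow> real \<Rightarrow> (real^'n) \<Rightarrow>\<^sub>L real"
    and D2 :: "real^'n \<Rightarrow> real \<Rightarrow> (real^'n) \<Rightarrow>\<^sub>L (real^'n) \<Rightarrow>\<^sub>L real"
    and Dt :: "real^'n \<Rightarrow> real \<Rightarrow> real"
    where D: "\<And>x t. t \<in> I \<Longrightarrow> ((\<lambda>y. v y t) has_derivative D1 x t) (at x)"
      "\<And>x t. t \<in> I \<Longrightarrow> ((\<lambda>y. D1 y t) has_derivative D2 x t) (at x)"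
      "\<And>x t. t \<in> I \<Longrightarrow> (v x has_real_derivative Dt x t) (at t)"
    and cont: "continuous_on (UNIV \<times> I) (\<lambda>(x,t). v x t)" "continuous_on (UNIV \<times> I) (\<lambda>(x,t). D1 x t)"
      "continuous_on (UNIV \<times> I) (\<lambda>(x,t). D2 x t)" "continuous_on (UNIV \<times> I) (\<lambda>(x,t). Dt x t)"
    and gl: "\<And>x t. t \<in> I \<Longrightarrow> grad (\<lambda>y. v y t) x = (\<chi> i. D1 x t (axis i 1))"
      "\<And>x t. t \<in> I \<Longrightarrow> laplacian (\<lambda>y. v y t) x = (\<Sum>i\<in>UNIV. D2 x t (axis i 1) (axis i 1))"
    using C21_on_cases[OF v] by blast
  have \<eta>c: "continuous_on S \<eta>" "continuous_on S \<eta>'" for S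
    using \<eta> by (auto intro: continuous_at_imp_continuous_on DERIV_isCont continuous_on_subset)
  have E1: "((\<lambda>y. \<eta> t * v y t) has_derivative blinfun_apply (\<eta> t *\<^sub>R D1 x t)) (at x)" if "t \<in> I" for x t
    using D(1)[OF that] by (auto intro!: derivative_eq_intros simp: scaleR_blinfun.rep_eq)
  have E2: "((\<lambda>y. \<eta> t *\<^sub>R D1 y t) has_derivative blinfun_apply (\<eta> t *\<^sub>R D2 x t)) (at x)" if "t \<in> I" for x t
    using D(2)[OF that] by (auto intro!: derivative_eq_intros simp: scaleR_blinfun.rep_eq)
  have E3: "((\<lambda>t. \<eta> t * v x t) has_real_derivative \<eta>' t * v x t + \<eta> t * Dt x t) (at t)" if "t \<in> I" for x t
    using D(3)[OF that] \<eta>(1) by (auto intro!: derivative_eq_intros)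
  have c2: "continuous_on (UNIV \<times> I) (\<lambda>y. \<eta> (snd y))" "continuous_on (UNIV \<times> I) (\<lambda>y. \<eta>' (snd y))"
    by (auto intro!: continuous_on_compose2[OF \<eta>c(1)[of UNIV]] continuous_on_compose2[OF \<eta>c(2)[of UNIV]] continuous_intros)
  show "C21_on I (\<lambda>x t. \<eta> t * v x t)"
    unfolding C21_on_def
    by (rule exI[of _ "\<lambda>x t. \<eta> t *\<^sub>R D1 x t"], rule exI[of _ "\<lambda>x t. \<eta> t *\<^sub>R D2 x t"],
        rule exI[of _ "\<lambda>x t. \<eta>' t * v x t + \<eta> t * Dt x t"], intro conjI allI ballI E1 E2 E3)
      (use cont c2 in \<open>auto simp: split_beta intro!: continuous_intros\<close>)
  show "deriv (\<lambda>t. \<eta> t * v x t) t = \<eta>' t * v x t + \<eta> t * deriv (v x) t" if "t \<in> I"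
    using DERIV_imp_deriv[OF E3[OF that]] DERIV_imp_deriv[OF D(3)[OF that]] by simp
  show "grad (\<lambda>y. \<eta> t * v y t) x = \<eta> t *\<^sub>R grad (\<lambda>y. v y t) x" if "t \<in> I"
    using has_derivative_imp_grad(1)[OF E1[OF that]] gl(1)[OF that]
    by (simp add: vec_eq_iff scaleR_blinfun.rep_eq)
  show "laplacian (\<lambda>y. \<eta> t * v y t) x = \<eta> t * laplacian (\<lambda>y. v y t) x" if "t \<in> I"
    using laplacian_eq[OF E1[OF that] E2[OF that]] gl(2)[OF that]
    by (simp add: scaleR_blinfun.rep_eq sum_distrib_left)
qed

lemma C21_on_subset:
  fixes v :: "real^'n \<Rightarrow> real \<Rightarrow> real"
  assumes "C21_on I v" "J \<subseteq> I"
  shows "C21_on J v"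
proof -
  have "(UNIV :: (real^'n) set) \<times> J \<subseteq> UNIV \<times> I" using assms(2) by auto
  note cont = continuous_on_subset[OF _ this]
  show ?thesis
    using assms unfolding C21_on_def
  proof (elim exE conjE)
    fix D1 D2 Dt
    assume "\<forall>x. \<forall>t\<in>I. ((\<lambda>y. v y t) has_derivative blinfun_apply (D1 x t)) (at x) \<and>
        ((\<lambda>y. D1 y t) has_derivative blinfun_apply (D2 x t)) (at x) \<and>
        (v x has_real_derivative Dt x t) (at t)"
      and "continuous_on (UNIV \<times> I) (\<lambda>(x,t). v x t)" "continuous_on (UNIV \<times> I) (\<lambda>(x,t). D1 x t)"
        "continuous_on (UNIV \<times> I) (\<lambda>(x,t). D2 x t)" "continuous_on (UNIV \<times> I) (\<lambda>(x,t). Dt x t)"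
    with assms(2) show "\<exists>D1 D2 Dt. (\<forall>x. \<forall>t\<in>J. ((\<lambda>y. v y t) has_derivative blinfun_apply (D1 x t)) (at x) \<and>
        ((\<lambda>y. D1 y t) has_derivative blinfun_apply (D2 x t)) (at x) \<and>
        (v x has_real_derivative Dt x t) (at t)) \<and>
        continuous_on (UNIV \<times> J) (\<lambda>(x,t). v x t) \<and> continuous_on (UNIV \<times> J) (\<lambda>(x,t). D1 x t) \<and>
        continuous_on (UNIV \<times> J) (\<lambda>(x,t). D2 x t) \<and> continuous_on (UNIV \<times> J) (\<lambda>(x,t). Dt x t)"
      by (intro exI[of _ D1] exI[of _ D2] exI[of _ Dt] conjI cont) auto
  qed
qed

section \<open>Integration over the unit cell\<close>

abbreviation closed_cell :: "(real^'n) set" where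
  "closed_cell \<equiv> cbox 0 (\<chi> i. 1)"

lemma unit_cell_subset: "unit_cell \<subseteq> closed_cell"
  by (auto simp: unit_cell_def mem_box_cart less_imp_le)

lemma ex_shift_to_unit_cell:
  fixes x :: "real^'n"
  obtains k :: "real^'n" where "\<And>i. k $ i \<in> \<int>" "x + k \<in> unit_cell"
proof
  show "(\<chi> i. - (of_int \<lfloor>x $ i\<rfloor> :: real)) $ i \<in> \<int>" for i by simp
  show "x + (\<chi> i. - of_int \<lfloor>x $ i\<rfloor>) \<in> unit_cell"
    by (auto simp: unit_cell_def) linarith
qed

lemma sets_unit_cell [measurable]: "unit_cell \<in> sets borel"
proof -
  have "unit_cell = (\<Inter>i::'n. {x. 0 \<le> x $ i} \<inter> {x :: real^'n. x $ i < 1})"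
    by (auto simp: unit_cell_def)
  moreover have "{x. 0 \<le> x $ i} \<inter> {x :: real^'n. x $ i < 1} \<in> sets borel" for i
    by (intro sets.Int borel_closed borel_open closed_Collect_le open_Collect_less continuous_intros)
  ultimately show ?thesis by (metis (no_types, lifting) sets.finite_INT finite_class.finite_UNIV UNIV_not_empty)
qed

text \<open>
  The half-open cell differs from the compact cube by a null set, so the results on
  integrals over compact boxes apply to it.
\<close>

lemma cell_integral:
  fixes f :: "real^'n \<Rightarrow> real"
  assumes f: "continuous_on UNIV f"
  shows "set_integrable lborel unit_cell f"
    and "(LINT x:unit_cell|lborel. f x) = integral closed_cell f"
proof -
  have int: "set_integrable lborel closed_cell f"
    by (rule borel_integrable_compact[folded set_integrable_def]) 
      (auto intro: continuous_on_subset[OF f])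
  then show "set_integrable lborel unit_cell f"
    by (rule set_integrable_subset) (auto simp: unit_cell_subset)
  have "closed_cell - box 0 (\<chi> i. 1) \<in> null_sets (lborel :: (real^'n) measure)"
    using negligible_frontier_interval[of "0 :: real^'n" "\<chi> i. 1"]
    by (auto simp: negligible_iff_null_sets null_sets_def)
  then have "AE x in lborel. x \<notin> closed_cell - box 0 (\<chi> i::'n. (1::real))"
    by (rule AE_not_in)
  moreover have "indicator unit_cell x *\<^sub>R f x = indicator closed_cell x *\<^sub>R f x"
    if "x \<notin> closed_cell - box 0 (\<chi> i::'n. (1::real))" for x
    using that unit_cell_subset
    by (auto simp: indicator_def unit_cell_def mem_box_cart less_imp_le)
  ultimately have "(LINT x:unit_cell|lborel. f x) = (LINT x:closed_cell|lborel. f x)"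
    unfolding set_lebesgue_integral_def using borel_measurable_continuous_onI[OF f]
    by (intro integral_cong_AE) auto
  also have "\<dots> = integral closed_cell f"
    by (rule set_borel_integral_eq_integral[OF int])
  finally show "(LINT x:unit_cell|lborel. f x) = integral closed_cell f" .
qed

lemma continuous_on_slice:
  assumes "continuous_on (UNIV \<times> S) (\<lambda>(x,t). f x t)" "t \<in> S"
  shows "continuous_on UNIV (\<lambda>x. f x t)"
  by (rule continuous_on_compose2[OF assms(1), of UNIV "\<lambda>x. (x,t)", simplified])
    (use assms(2) in \<open>auto intro!: continuous_intros\<close>)

lemma cell_integral_continuous:
  fixes f :: "real^'n \<Rightarrow> real \<Rightarrow> real"
  assumes f: "continuous_on (UNIV \<times> S) (\<lambda>(x,t). f x t)"
  shows "continuous_on S (\<lambda>t. LINT x:unit_cell|lborel. f x t)"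
proof -
  have "continuous_on S (\<lambda>t. integral closed_cell (\<lambda>x. f x t))"
    by (rule integral_continuous_on_param)
      (auto simp: split_beta intro!: continuous_on_compose2[OF f, of _ "\<lambda>y. (snd y, fst y)", simplified split_beta fst_conv snd_conv] continuous_intros)
  moreover have "(LINT x:unit_cell|lborel. f x t) = integral closed_cell (\<lambda>x. f x t)" if "t \<in> S" for t
    by (rule cell_integral(2)[OF continuous_on_slice[OF f that]])
  ultimately show ?thesis by (simp cong: continuous_on_cong)
qed

section \<open>Iterated integrals without measurability of the kernel\<close>

text \<open>
  The integral of an arbitrary nonnegative function is a lower integral, that is, a supremum over
  simple minorants.  Countably many of them approach it, and their supremum is a measurable minorant
  with the same integral.
\<close>

lemma nn_integral_measurable_minorant:
  obtains h where "h \<in> borel_measurable M" "h \<le> f" "(\<integral>\<^sup>+x. h x \<partial>M) = (\<integral>\<^sup>+x. f x \<partial>M)"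
proof -
  let ?S = "{g. simple_function M g \<and> g \<le> f}"
  have "(\<lambda>_. 0) \<in> ?S" by (auto simp: le_fun_def)
  then have "?S \<noteq> {}" by blast
  then obtain s :: "nat \<Rightarrow> ennreal" where s: "range s \<subseteq> integral\<^sup>S M ` ?S"
      "Sup (integral\<^sup>S M ` ?S) = (SUP i. s i)"
    using ennreal_SUP_countable_SUP[of ?S "integral\<^sup>S M"] by blast
  then have "\<exists>g. \<forall>i. g i \<in> ?S \<and> s i = integral\<^sup>S M (g i)" by (intro choice) blast
  then obtain g where g: "\<And>i. simple_function M (g i)" "\<And>i. g i \<le> f" "\<And>i. s i = integral\<^sup>S M (g i)"
    by auto
  show thesis
  proof
    show m: "(\<lambda>x. SUP i. g i x) \<in> borel_measurable M"
      by (intro borel_measurable_SUP borel_measurable_simple_function g) auto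
    show le: "(\<lambda>x. SUP i. g i x) \<le> f"
      using g(2) by (auto simp: le_fun_def intro: SUP_least)
    show "(\<integral>\<^sup>+x. (SUP i. g i x) \<partial>M) = (\<integral>\<^sup>+x. f x \<partial>M)"
    proof (rule antisym)
      show "(\<integral>\<^sup>+x. (SUP i. g i x) \<partial>M) \<le> (\<integral>\<^sup>+x. f x \<partial>M)"
        using le by (intro nn_integral_mono) (auto simp: le_fun_def)
      have "s i \<le> (\<integral>\<^sup>+x. (SUP i. g i x) \<partial>M)" for i
        unfolding g(3) by (subst nn_integral_eq_simple_integral[OF g(1), symmetric])
          (intro nn_integral_mono SUP_upper, auto)
      then show "(\<integral>\<^sup>+x. f x \<partial>M) \<le> (\<integral>\<^sup>+x. (SUP i. g i x) \<partial>M)"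
        unfolding nn_integral_def[of M f] s(2) by (rule SUP_least)
    qed
  qed
qed

text \<open>
  Replacing both functions by measurable minorants leaves the left-hand side unchanged, makes the
  integral additive, and can only decrease the right-hand side.
\<close>

lemma nn_integral_superadditive:
  "(\<integral>\<^sup>+x. f x \<partial>M) + (\<integral>\<^sup>+x. g x \<partial>M) \<le> (\<integral>\<^sup>+x. f x + g x \<partial>M)"
proof -
  obtain h where h: "h \<in> borel_measurable M" "h \<le> f" "(\<integral>\<^sup>+x. h x \<partial>M) = (\<integral>\<^sup>+x. f x \<partial>M)"
    by (rule nn_integral_measurable_minorant)
  obtain k where k: "k \<in> borel_measurable M" "k \<le> g" "(\<integral>\<^sup>+x. k x \<partial>M) = (\<integral>\<^sup>+x. g x \<partial>M)"
    by (rule nn_integral_measurable_minorant)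
  have "(\<integral>\<^sup>+x. f x \<partial>M) + (\<integral>\<^sup>+x. g x \<partial>M) = (\<integral>\<^sup>+x. h x + k x \<partial>M)"
    using h k by (simp add: nn_integral_add)
  also have "\<dots> \<le> (\<integral>\<^sup>+x. f x + g x \<partial>M)"
    using h(2) k(2) by (intro nn_integral_mono add_mono) (auto simp: le_fun_def)
  finally show ?thesis .
qed

lemma nn_integral_cmult_le:
  "c * (\<integral>\<^sup>+x. f x \<partial>M) \<le> (\<integral>\<^sup>+x. c * f x \<partial>M)"
proof -
  obtain h where h: "h \<in> borel_measurable M" "h \<le> f" "(\<integral>\<^sup>+x. h x \<partial>M) = (\<integral>\<^sup>+x. f x \<partial>M)"
    by (rule nn_integral_measurable_minorant)
  have "c * (\<integral>\<^sup>+x. f x \<partial>M) = (\<integral>\<^sup>+x. c * h x \<partial>M)"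
    using h by (simp add: nn_integral_cmult)
  also have "\<dots> \<le> (\<integral>\<^sup>+x. c * f x \<partial>M)"
    using h(2) by (intro nn_integral_mono mult_left_mono) (auto simp: le_fun_def)
  finally show ?thesis .
qed

text \<open>
  One half of Tonelli's theorem survives when \<open>N t\<close> does not depend measurably on \<open>t\<close>: in the
  induction over measurable functions, the steps for multiples, sums and suprema use of the lower
  integral only that it is monotone, superadditive and grows at least linearly under scaling.
\<close>

lemma nn_integral_le_iterated:
  fixes F :: "'b \<Rightarrow> ennreal" and j :: "'t \<Rightarrow> 'a \<Rightarrow> 'b"
  assumes F: "F \<in> borel_measurable M"
    and j: "\<And>t. t \<in> space L \<Longrightarrow> j t \<in> measurable (N t) M"
    and M: "\<And>A. A \<in> sets M \<Longrightarrow> emeasure M A = (\<integral>\<^sup>+t. (\<integral>\<^sup>+y. indicator A (j t y) \<partial>N t) \<partial>L)"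
  shows "(\<integral>\<^sup>+y. F y \<partial>M) \<le> (\<integral>\<^sup>+t. (\<integral>\<^sup>+y. F (j t y) \<partial>N t) \<partial>L)"
  using F
proof (induction rule: borel_measurable_induct)
  case (cong f g)
  have "(\<integral>\<^sup>+y. g y \<partial>M) = (\<integral>\<^sup>+y. f y \<partial>M)"
    using cong(3) by (intro nn_integral_cong) auto
  moreover have "(\<integral>\<^sup>+t. (\<integral>\<^sup>+y. g (j t y) \<partial>N t) \<partial>L) = (\<integral>\<^sup>+t. (\<integral>\<^sup>+y. f (j t y) \<partial>N t) \<partial>L)"
    using cong(3) measurable_space[OF j] by (intro nn_integral_cong) auto
  ultimately show ?case using cong by simp
next
  case (set A)
  then show ?case by (simp add: M)
next
  case (mult u c)
  have "(\<integral>\<^sup>+y. c * u y \<partial>M) = c * (\<integral>\<^sup>+y. u y \<partial>M)"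
    using mult by (simp add: nn_integral_cmult)
  also have "\<dots> \<le> c * (\<integral>\<^sup>+t. (\<integral>\<^sup>+y. u (j t y) \<partial>N t) \<partial>L)"
    by (intro mult_left_mono mult.IH) auto
  also have "\<dots> \<le> (\<integral>\<^sup>+t. c * (\<integral>\<^sup>+y. u (j t y) \<partial>N t) \<partial>L)"
    by (rule nn_integral_cmult_le)
  also have "\<dots> \<le> (\<integral>\<^sup>+t. (\<integral>\<^sup>+y. c * u (j t y) \<partial>N t) \<partial>L)"
    by (intro nn_integral_mono nn_integral_cmult_le)
  finally show ?case .
next
  case (add u v)
  have "(\<integral>\<^sup>+y. v y + u y \<partial>M) = (\<integral>\<^sup>+y. v y \<partial>M) + (\<integral>\<^sup>+y. u y \<partial>M)"
    using add by (simp add: nn_integral_add)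
  also have "\<dots> \<le> (\<integral>\<^sup>+t. (\<integral>\<^sup>+y. v (j t y) \<partial>N t) \<partial>L) + (\<integral>\<^sup>+t. (\<integral>\<^sup>+y. u (j t y) \<partial>N t) \<partial>L)"
    by (intro add_mono add.IH)
  also have "\<dots> \<le> (\<integral>\<^sup>+t. (\<integral>\<^sup>+y. v (j t y) \<partial>N t) + (\<integral>\<^sup>+y. u (j t y) \<partial>N t) \<partial>L)"
    by (rule nn_integral_superadditive)
  also have "\<dots> \<le> (\<integral>\<^sup>+t. (\<integral>\<^sup>+y. v (j t y) + u (j t y) \<partial>N t) \<partial>L)"
    by (intro nn_integral_mono nn_integral_superadditive)
  finally show ?case .
next
  case (seq U)
  have "(\<integral>\<^sup>+y. (SUP i. U i) y \<partial>M) = (SUP i. \<integral>\<^sup>+y. U i y \<partial>M)"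
    using seq by (simp add: nn_integral_monotone_convergence_SUP image_comp)
  also have "\<dots> \<le> (\<integral>\<^sup>+t. (\<integral>\<^sup>+y. (SUP i. U i) (j t y) \<partial>N t) \<partial>L)"
  proof (rule SUP_least)
    fix i
    have "(\<integral>\<^sup>+y. U i y \<partial>M) \<le> (\<integral>\<^sup>+t. (\<integral>\<^sup>+y. U i (j t y) \<partial>N t) \<partial>L)" by (rule seq.IH)
    also have "\<dots> \<le> (\<integral>\<^sup>+t. (\<integral>\<^sup>+y. (SUP i. U i) (j t y) \<partial>N t) \<partial>L)"
      by (intro nn_integral_mono) (auto simp: image_comp intro: SUP_upper)
    finally show "(\<integral>\<^sup>+y. U i y \<partial>M) \<le> (\<integral>\<^sup>+t. (\<integral>\<^sup>+y. (SUP i. U i) (j t y) \<partial>N t) \<partial>L)" .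
  qed
  finally show ?case .
qed

text \<open>
  For a bounded function the other half follows from the same inequality applied to the
  function reflected at its bound, since both sides have the same total mass.
\<close>

lemma integral_eq_iterated:
  fixes f :: "'b \<Rightarrow> real" and j :: "'t \<Rightarrow> 'a \<Rightarrow> 'b"
  assumes M: "finite_measure M" and L: "finite_measure L"
    and N: "\<And>t. t \<in> space L \<Longrightarrow> prob_space (N t)"
    and j: "\<And>t. t \<in> space L \<Longrightarrow> j t \<in> measurable (N t) M"
    and disint: "\<And>A. A \<in> sets M \<Longrightarrow> emeasure M A = (\<integral>\<^sup>+t. (\<integral>\<^sup>+y. indicator A (j t y) \<partial>N t) \<partial>L)"
    and f: "f \<in> borel_measurable M" and fM: "AE y in M. \<bar>f y\<bar> \<le> b"
    and fN: "\<And>t. t \<in> space L \<Longrightarrow> AE y in N t. \<bar>f (j t y)\<bar> \<le> b"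
    and meas: "(\<lambda>t. \<integral>y. f (j t y) \<partial>N t) \<in> borel_measurable L"
  shows "(\<integral>y. f y \<partial>M) = (\<integral>t. (\<integral>y. f (j t y) \<partial>N t) \<partial>L)"
proof -
  interpret M: finite_measure M by fact
  interpret L: finite_measure L by fact
  have "emeasure M (space M) = (\<integral>\<^sup>+t. 1 \<partial>L)"
    unfolding disint[OF sets.top]
  proof (intro nn_integral_cong)
    fix t assume t: "t \<in> space L"
    interpret Nt: prob_space "N t" by (rule N[OF t])
    have "(\<integral>\<^sup>+y. indicator (space M) (j t y) \<partial>N t) = (\<integral>\<^sup>+y. 1 \<partial>N t)"
      using measurable_space[OF j[OF t]] by (intro nn_integral_cong) auto
    then show "(\<integral>\<^sup>+y. indicator (space M) (j t y) \<partial>N t) = 1" by (simp add: Nt.emeasure_space_1)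
  qed
  then have mass: "measure M (space M) = measure L (space L)" by (simp add: measure_def)
  define I where "I t = (\<integral>y. f (j t y) \<partial>N t)" for t
  have Nt: "\<bar>I t\<bar> \<le> b" "(\<integral>\<^sup>+y. ennreal (b + c * f (j t y)) \<partial>N t) = ennreal (b + c * I t)"
    if t: "t \<in> space L" and c: "c = 1 \<or> c = -1" for t c
  proof -
    interpret Nt: prob_space "N t" by (rule N[OF t])
    have m: "(\<lambda>y. f (j t y)) \<in> borel_measurable (N t)" by (rule measurable_compose[OF j[OF t] f])
    have i: "integrable (N t) (\<lambda>y. f (j t y))"
      by (rule Nt.integrable_const_bound[where B=b]) (use fN[OF t] m in auto)
    have "AE y in N t. 0 \<le> b + c * f (j t y)" using fN[OF t] by eventually_elim (use c in auto)
    then have "(\<integral>\<^sup>+y. ennreal (b + c * f (j t y)) \<partial>N t) = ennreal (\<integral>y. b + c * f (j t y) \<partial>N t)"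
      using i by (intro nn_integral_eq_integral) auto
    then show "(\<integral>\<^sup>+y. ennreal (b + c * f (j t y)) \<partial>N t) = ennreal (b + c * I t)"
      using i by (simp add: I_def Nt.prob_space)
    have "AE y in N t. f (j t y) \<le> b" "AE y in N t. - b \<le> f (j t y)"
      using fN[OF t] by auto
    then have "I t \<le> b" "- b \<le> I t"
      unfolding I_def using i by (auto intro: Nt.integral_le_const Nt.integral_ge_const)
    then show "\<bar>I t\<bar> \<le> b" by simp
  qed
  have Ib: "\<bar>I t\<bar> \<le> b" if "t \<in> space L" for t using Nt(1)[OF that, of 1] by simp
  have "I \<in> borel_measurable L" using meas by (simp add: I_def[abs_def])
  then have I: "integrable L I"
    by (intro L.integrable_const_bound[where B=b]) (use Ib in auto)
  have i: "integrable M f"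
    by (rule M.integrable_const_bound[where B=b]) (use f fM in auto)
  \<comment> \<open>Only one inequality is available for each sign of \<open>f\<close>; adding the constant \<open>b\<close> makes both
    integrands nonnegative.\<close>
  have le: "c * (\<integral>y. f y \<partial>M) \<le> c * (\<integral>t. I t \<partial>L)" if c: "c = 1 \<or> c = -1" for c :: real
  proof -
    have nn: "0 \<le> b + c * I t" if "t \<in> space L" for t using Ib[OF that] c by auto
    have "AE y in M. 0 \<le> b + c * f y" using fM by eventually_elim (use c in auto)
    then have "ennreal (\<integral>y. b + c * f y \<partial>M) = (\<integral>\<^sup>+y. ennreal (b + c * f y) \<partial>M)"
      using i by (intro nn_integral_eq_integral[symmetric]) auto
    also have "\<dots> \<le> (\<integral>\<^sup>+t. (\<integral>\<^sup>+y. ennreal (b + c * f (j t y)) \<partial>N t) \<partial>L)"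
      by (rule nn_integral_le_iterated[OF _ j disint]) (use f in auto)
    also have "\<dots> = (\<integral>\<^sup>+t. ennreal (b + c * I t) \<partial>L)"
      by (intro nn_integral_cong Nt c) auto
    also have "\<dots> = ennreal (\<integral>t. b + c * I t \<partial>L)"
      using I nn by (intro nn_integral_eq_integral AE_I2) auto
    finally have "ennreal (\<integral>y. b + c * f y \<partial>M) \<le> ennreal (\<integral>t. b + c * I t \<partial>L)" .
    moreover have "0 \<le> (\<integral>t. b + c * I t \<partial>L)"
      using nn by (intro integral_nonneg_AE AE_I2) auto
    ultimately have "(\<integral>y. b + c * f y \<partial>M) \<le> (\<integral>t. b + c * I t \<partial>L)" by (simp add: ennreal_le_iff)
    then show ?thesis using i I mass by simp
  qed
  show ?thesis using le[of 1] le[of "-1"] by (simp add: I_def)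
qed

section \<open>The duality formula\<close>

text \<open>
  If \<open>A' = B\<close> holds weakly and \<open>P' = B\<close>, then \<open>D = A - P\<close> satisfies \<open>\<integral> \<eta>' D = 0\<close> for all admissible
  \<open>\<eta>\<close>.  The particular \<open>\<eta>\<close> with \<open>\<eta>' = \<zeta> (D - c)\<close>, where the weight \<open>\<zeta>\<close>
  vanishes at the ends of the interval and \<open>c\<close> is the \<open>\<zeta>\<close>-weighted mean of \<open>D\<close>, is continuously
  differentiable and compactly supported, and gives \<open>\<integral> \<zeta> (D - c)\<^sup>2 = 0\<close>.
\<close>

lemma du_bois_reymond:
  fixes A B :: "real \<Rightarrow> real"
  assumes A: "continuous_on {0<..<T} A" and B: "continuous_on {0<..<T} B"
    and weak: "\<And>\<eta> \<eta>' a b. \<lbrakk>\<And>t. (\<eta> has_real_derivative \<eta>' t) (at t); continuous_on UNIV \<eta>';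
        0 < a; a < b; b < T; \<And>t. t \<notin> {a..b} \<Longrightarrow> \<eta> t = 0; \<And>t. t \<notin> {a..b} \<Longrightarrow> \<eta>' t = 0\<rbrakk> \<Longrightarrow>
        (LINT t:{0<..<T}|lborel. \<eta>' t * A t + \<eta> t * B t) = 0"
    and ab: "0 < a" "a < b" "b < T"
  shows "A b - A a = integral {a..b} B"
proof -
  have "0 < T" using ab by simp
  have "\<exists>P. \<forall>t. ereal 0 < ereal t \<longrightarrow> ereal t < ereal T \<longrightarrow> (P has_vector_derivative B t) (at t)"
    by (rule einterval_antiderivative)
      (use \<open>0 < T\<close> B in \<open>auto simp: continuous_on_eq_continuous_at\<close>)
  then obtain P where P: "\<And>t. 0 < t \<Longrightarrow> t < T \<Longrightarrow> (P has_real_derivative B t) (at t)"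
    by (auto simp: has_real_derivative_iff_has_vector_derivative)
  have Pcont: "continuous_on {0<..<T} P"
    by (intro continuous_at_imp_continuous_on ballI DERIV_isCont) (use P in auto)
  define D where "D t = A t - P t" for t
  define a1 where "a1 = a / 2"
  define b1 where "b1 = (b + T) / 2"
  have ab1: "0 < a1" "a1 < a" "b < b1" "b1 < T" "a1 < b1" using ab by (auto simp: a1_def b1_def)
  have sub: "{a1..b1} \<subseteq> {0<..<T}" using ab1 by auto
  note cs = continuous_on_subset[OF _ sub]
  define \<zeta> where "\<zeta> t = (t - a1) * (b1 - t)" for t
  have \<zeta>_nonneg: "0 \<le> \<zeta> t" if "t \<in> {a1..b1}" for t using that by (auto simp: \<zeta>_def)
  have \<zeta>_pos: "0 < \<zeta> t" if "t \<in> {a1<..<b1}" for t using that by (auto simp: \<zeta>_def)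
  have \<zeta>c: "continuous_on S \<zeta>" for S unfolding \<zeta>_def by (intro continuous_intros)
  have Dc: "continuous_on {a1..b1} D" unfolding D_def by (intro continuous_intros cs A Pcont)
  have "integral {a1..b1} \<zeta> \<noteq> 0"
    using integral_eq_0_iff[OF \<zeta>c _ \<zeta>_nonneg, of] ab1 \<zeta>_pos[of a] ab by force
  define c where "c = integral {a1..b1} (\<lambda>t. \<zeta> t * D t) / integral {a1..b1} \<zeta>"
  define q where "q t = (if t \<in> {a1..b1} then \<zeta> t * (D t - c) else 0)" for t
  \<comment> \<open>The two closed pieces overlap in \<open>a1\<close> and \<open>b1\<close>, where \<open>\<zeta>\<close> vanishes.\<close>
  have "continuous_on ({a1..b1} \<union> - {a1<..<b1}) q"
    unfolding q_def
    by (rule continuous_on_cases) (auto simp: \<zeta>_def D_def intro!: continuous_intros cs A Pcont)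
  moreover have "{a1..b1} \<union> - {a1<..<b1} = UNIV" by auto
  ultimately have qc: "continuous_on UNIV q" by simp
  have "\<exists>F. \<forall>t. - \<infinity> < ereal t \<longrightarrow> ereal t < \<infinity> \<longrightarrow> (F has_vector_derivative q t) (at t)"
    by (rule einterval_antiderivative) (use qc in \<open>auto simp: continuous_on_eq_continuous_at\<close>)
  then obtain F where F: "\<And>t. (F has_real_derivative q t) (at t)"
    by (auto simp: has_real_derivative_iff_has_vector_derivative)
  define \<eta> where "\<eta> t = F t - F a1" for t
  have \<eta>: "(\<eta> has_real_derivative q t) (at t)" for t
    unfolding \<eta>_def by (auto intro!: derivative_eq_intros F)
  have ftc: "integral {s..r} q = \<eta> r - \<eta> s" if "s \<le> r" for s r
    by (intro integral_unique fundamental_theorem_of_calculus that)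
      (use \<eta> in \<open>auto simp: has_real_derivative_iff_has_vector_derivative has_vector_derivative_at_within\<close>)
  have q_int: "integral {a1..b1} q = 0"
  proof -
    have "integral {a1..b1} q = integral {a1..b1} (\<lambda>t. \<zeta> t * D t - c * \<zeta> t)"
      by (intro integral_cong) (auto simp: q_def algebra_simps)
    also have "\<dots> = integral {a1..b1} (\<lambda>t. \<zeta> t * D t) - integral {a1..b1} (\<lambda>t. c * \<zeta> t)"
      by (intro Henstock_Kurzweil_Integration.integral_diff integrable_continuous_interval continuous_intros \<zeta>c Dc)
    also have "\<dots> = 0" using \<open>integral {a1..b1} \<zeta> \<noteq> 0\<close> by (simp add: c_def)
    finally show ?thesis .
  qed
  have \<eta>a: "\<eta> a1 = 0" by (simp add: \<eta>_def)
  then have \<eta>b: "\<eta> b1 = 0" using ftc[of a1 b1] q_int ab1 by simp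
  have \<eta>0: "\<eta> t = 0" if "t \<notin> {a1..b1}" for t
  proof (cases "t < a1")
    case True
    have "integral {t..a1} q = integral {t..a1} (\<lambda>_. 0)"
      by (intro integral_cong) (auto simp: q_def \<zeta>_def)
    then show ?thesis using ftc[of t a1] True \<eta>a by simp
  next
    case False
    then have "b1 < t" using that by auto
    have "integral {b1..t} q = integral {b1..t} (\<lambda>_. 0)"
      by (intro integral_cong) (auto simp: q_def \<zeta>_def)
    then show ?thesis using ftc[of b1 t] \<open>b1 < t\<close> \<eta>b by simp
  qed
  have q0: "q t = 0" if "t \<notin> {a1..b1}" for t using that unfolding q_def by (rule if_not_P)
  have \<eta>c: "continuous_on S \<eta>" for S
    by (intro continuous_at_imp_continuous_on ballI DERIV_isCont) (use \<eta> in auto)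
  have qcs: "continuous_on S q" for S using qc continuous_on_subset by blast
  have "0 = (LINT t:{0<..<T}|lborel. q t * A t + \<eta> t * B t)"
    by (rule weak[OF \<eta> qc, of a1 b1, symmetric]) (use ab1 \<eta>0 q0 in auto)
  also have "\<dots> = (LINT t:{a1..b1}|lborel. q t * A t + \<eta> t * B t)"
    unfolding set_lebesgue_integral_def
    by (intro Bochner_Integration.integral_cong) (use sub \<eta>0 q0 in \<open>auto simp: indicator_def\<close>)
  also have "\<dots> = integral {a1..b1} (\<lambda>t. q t * A t + \<eta> t * B t)"
    by (intro set_borel_integral_eq_integral borel_integrable_atLeastAtMost' continuous_intros cs A B \<eta>c qcs)
  also have "\<dots> = integral {a1..b1} (\<lambda>t. q t * (D t - c) + c * q t + (\<eta> t * B t + q t * P t))"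
    by (intro integral_cong) (auto simp: D_def algebra_simps)
  also have "\<dots> = integral {a1..b1} (\<lambda>t. q t * (D t - c)) + integral {a1..b1} (\<lambda>t. c * q t)
      + integral {a1..b1} (\<lambda>t. \<eta> t * B t + q t * P t)"
    by (subst Henstock_Kurzweil_Integration.integral_add Henstock_Kurzweil_Integration.integral_add,
        (intro integrable_continuous_interval continuous_intros cs A B Dc Pcont qcs \<eta>c)+)+ simp
  also have "integral {a1..b1} (\<lambda>t. \<eta> t * B t + q t * P t) = \<eta> b1 * P b1 - \<eta> a1 * P a1"
  proof (intro integral_unique fundamental_theorem_of_calculus)
    fix t assume "t \<in> {a1..b1}"
    then have "0 < t" "t < T" using ab1 by auto
    then have "((\<lambda>t. \<eta> t * P t) has_real_derivative \<eta> t * B t + q t * P t) (at t)"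
      by (auto intro!: derivative_eq_intros P \<eta>)
    then show "((\<lambda>t. \<eta> t * P t) has_vector_derivative \<eta> t * B t + q t * P t) (at t within {a1..b1})"
      by (auto simp: has_real_derivative_iff_has_vector_derivative has_vector_derivative_at_within)
  qed (use ab1 in auto)
  finally have "integral {a1..b1} (\<lambda>t. q t * (D t - c)) = 0"
    by (simp add: q_int \<eta>a \<eta>b)
  moreover have "integral {a1..b1} (\<lambda>t. q t * (D t - c)) = integral {a1..b1} (\<lambda>t. \<zeta> t * (D t - c)\<^sup>2)"
    by (intro integral_cong) (auto simp: q_def power2_eq_square)
  ultimately have "integral {a1..b1} (\<lambda>t. \<zeta> t * (D t - c)\<^sup>2) = 0" by simp
  moreover have "continuous_on {a1..b1} (\<lambda>t. \<zeta> t * (D t - c)\<^sup>2)"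
    by (intro continuous_intros \<zeta>c Dc)
  ultimately have z: "\<zeta> t * (D t - c)\<^sup>2 = 0" if "t \<in> {a1..b1}" for t
    using integral_eq_0_iff[of a1 b1 "\<lambda>t. \<zeta> t * (D t - c)\<^sup>2"] ab1 \<zeta>_nonneg that by auto
  have "D a = c" "D b = c"
    using z[of a] z[of b] \<zeta>_pos[of a] \<zeta>_pos[of b] ab ab1 by auto
  moreover have "integral {a..b} B = P b - P a"
  proof (intro integral_unique fundamental_theorem_of_calculus)
    fix t assume "t \<in> {a..b}"
    then have "0 < t" "t < T" using ab by auto
    then show "(P has_vector_derivative B t) (at t within {a..b})"
      using P[of t] by (auto simp: has_real_derivative_iff_has_vector_derivative has_vector_derivative_at_within)
  qed (use ab in auto)
  ultimately show ?thesis by (simp add: D_def)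
qed

text \<open>
  If \<open>H\<close> is convex in \<open>p\<close>, this is the Lagrangian (the Legendre transform of \<open>H x\<close>) at the velocity
  \<open>D\<^sub>pH(x,p)\<close>.
\<close>

definition action_density :: "(real^'n \<Rightarrow> real^'n \<Rightarrow> real) \<Rightarrow> real^'n \<Rightarrow> real^'n \<Rightarrow> real" where
  "action_density H x p = grad (H x) p \<bullet> p - H x p"

lemma continuous_on_action_density:
  assumes "C2_on UNIV (\<lambda>(x,p). H x p)"
  shows "continuous_on UNIV (\<lambda>(x,p). action_density H x p)"
  using continuous_on_momentum_grad[OF assms] unfolding action_density_def split_beta
  by (intro continuous_intros)

lemma periodic_action_density:
  assumes "\<And>p. periodic (\<lambda>x. H x p)"
  shows "periodic (\<lambda>x. action_density H x p)"
proof -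
  have "H (x + k) = H x" if "\<forall>i. k $ i \<in> \<int>" for x k
    using assms that unfolding periodic_def by (intro ext) blast
  then show ?thesis by (simp add: periodic_def action_density_def)
qed

lemma viscous_solutionD:
  assumes "viscous_solution \<epsilon> H g v"
  shows "t \<ge> 0 \<Longrightarrow> periodic (\<lambda>x. v x t)" "continuous_on (UNIV \<times> {0..}) (\<lambda>(x,t). v x t)"
    "C21_on {0<..} v" "v x 0 = g x"
    "t > 0 \<Longrightarrow> deriv (v x) t + H x (grad (\<lambda>y. v y t) x) = \<epsilon> * laplacian (\<lambda>y. v y t) x"
  using assms unfolding viscous_solution_def by blast+

lemma adjoint_solutionD:
  assumes "adjoint_solution \<epsilon> H v z T s"
  shows "t \<in> {0..<T} \<Longrightarrow> periodic (\<lambda>x. s x t)" "continuous_on (UNIV \<times> {0..<T}) (\<lambda>(x,t). s x t)"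
    "C21_on {0<..<T} \<phi> \<Longrightarrow> (\<And>t. t \<in> {0<..<T} \<Longrightarrow> periodic (\<lambda>x. \<phi> x t)) \<Longrightarrow>
      0 < a \<Longrightarrow> a < b \<Longrightarrow> b < T \<Longrightarrow> (\<And>x t. t \<notin> {a..b} \<Longrightarrow> \<phi> x t = 0) \<Longrightarrow>
      (LINT t:{0<..<T}|lborel. LINT x:unit_cell|lborel.
           s x t * (deriv (\<phi> x) t + grad (H x) (grad (\<lambda>y. v y t) x) \<bullet> grad (\<lambda>y. \<phi> y t) x
                    - \<epsilon> * laplacian (\<lambda>y. \<phi> y t) x)) = 0"
    "continuous_on UNIV \<phi>' \<Longrightarrow> periodic \<phi>' \<Longrightarrow>
      ((\<lambda>t. LINT x:unit_cell|lborel. \<phi>' x * s x t) \<longlongrightarrow> \<phi>' z) (at_left T)"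
  using assms unfolding adjoint_solution_def by blast+

lemma nu_measureD:
  assumes "nu_measure C w s N"
  shows "prob_space N" "sets N = sets borel" "AE y in N. y \<in> unit_cell \<times> cball 0 C"
    "continuous_on UNIV (\<lambda>(x,p). \<psi> x p) \<Longrightarrow> (\<And>p. periodic (\<lambda>x. \<psi> x p)) \<Longrightarrow>
      (LINT (x,p)|N. \<psi> x p) = (LINT x:unit_cell|lborel. \<psi> x (w x) * s x)"
  using assms unfolding nu_measure_def finite_borel_measure_on_def by blast+

lemma bounded_on_cell_times_cball:
  assumes "continuous_on UNIV (\<lambda>(x,p). \<psi> x p :: real)"
  obtains b where "\<And>x p :: real^'n. x \<in> unit_cell \<Longrightarrow> norm p \<le> C \<Longrightarrow> \<bar>\<psi> x p\<bar> \<le> b"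
proof -
  have "compact ((\<lambda>(x,p). \<psi> x p) ` (closed_cell \<times> cball 0 C))"
    by (intro compact_continuous_image compact_Times compact_cbox compact_cball
        continuous_on_subset[OF assms]) auto
  then obtain b where "\<And>y. y \<in> (\<lambda>(x,p). \<psi> x p) ` (closed_cell \<times> cball 0 C) \<Longrightarrow> norm y \<le> b"
    using compact_imp_bounded bounded_pos by (metis (no_types, lifting))
  then have "\<bar>\<psi> x p\<bar> \<le> b" if "x \<in> unit_cell" "norm p \<le> C" for x p
    using that unit_cell_subset by (force simp: image_iff)
  then show thesis by (rule that)
qed

lemma continuous_on_nu_integral:
  fixes \<psi> :: "real^'n \<Rightarrow> real^'n \<Rightarrow> real"
  assumes v: "C21_on {0<..} v" and s: "continuous_on (UNIV \<times> {0..<T}) (\<lambda>(x,t). s x t)"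
    and \<psi>: "continuous_on UNIV (\<lambda>(x,p). \<psi> x p)" "\<And>p. periodic (\<lambda>x. \<psi> x p)"
    and \<nu>: "\<And>t. t \<in> {0..<T} \<Longrightarrow> nu_measure C (grad (\<lambda>x. v x t)) (\<lambda>x. s x t) (\<nu> t)"
  shows "continuous_on {0<..<T} (\<lambda>t. LINT (x,p)|\<nu> t. \<psi> x p)"
proof -
  have "continuous_on (UNIV \<times> {0<..<T}) (\<lambda>(x,t). \<psi> x (grad (\<lambda>y. v y t) x) * s x t)"
    unfolding split_beta
    by (intro continuous_intros continuous_on_compose2[OF \<psi>(1)[unfolded split_beta], of _ "\<lambda>y. (fst y, grad (\<lambda>y'. v y' (snd y)) (fst y))", simplified]
        continuous_on_subset[OF continuous_on_spatial_grad[OF v, unfolded split_beta]]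
        continuous_on_subset[OF s[unfolded split_beta]]) auto
  then have "continuous_on {0<..<T} (\<lambda>t. LINT x:unit_cell|lborel. \<psi> x (grad (\<lambda>y. v y t) x) * s x t)"
    by (rule cell_integral_continuous)
  then show ?thesis
    by (rule continuous_on_eq) (use nu_measureD(4)[OF \<nu> \<psi>] in auto)
qed

text \<open>
  Testing the adjoint equation with \<open>\<eta>(t) v(x,t)\<close> produces the factor
  \<open>\<eta>' v + \<eta> (v\<^sub>t + D\<^sub>pH \<bullet> Dv - \<epsilon> \<Delta>v)\<close>, in which the viscous equation replaces \<open>v\<^sub>t - \<epsilon> \<Delta>v\<close> by \<open>-H\<close>.
  Only the action density is left, and no second derivatives of \<open>v\<close>.
\<close>

lemma adjoint_balance:
  fixes H :: "real^'n \<Rightarrow> real^'n \<Rightarrow> real"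
  assumes H: "C2_on UNIV (\<lambda>(x,p). H x p)"
    and v: "viscous_solution \<epsilon> H g v"
    and s: "adjoint_solution \<epsilon> H v z T s"
    and ab: "0 < a" "a < b" "b < T"
  shows "(LINT x:unit_cell|lborel. v x b * s x b) - (LINT x:unit_cell|lborel. v x a * s x a)
    = integral {a..b} (\<lambda>t. LINT x:unit_cell|lborel. action_density H x (grad (\<lambda>y. v y t) x) * s x t)"
proof -
  let ?w = "\<lambda>x t. grad (\<lambda>y. v y t) x"
  note vD = viscous_solutionD[OF v] and sD = adjoint_solutionD[OF s]
  define A where "A t = (LINT x:unit_cell|lborel. v x t * s x t)" for t
  define B where "B t = (LINT x:unit_cell|lborel. action_density H x (?w x t) * s x t)" for t
  have C21: "C21_on {0<..<T} v" by (rule C21_on_subset[OF vD(3)]) auto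
  have sc: "continuous_on (UNIV \<times> {0<..<T}) (\<lambda>(x,t). s x t)"
    by (rule continuous_on_subset[OF sD(2)]) auto
  have Ac: "continuous_on (UNIV \<times> {0<..<T}) (\<lambda>(x,t). v x t * s x t)"
    using sc continuous_on_subset[OF vD(2), of "UNIV \<times> {0<..<T}"] unfolding split_beta
    by (force intro!: continuous_intros)
  have Bc: "continuous_on (UNIV \<times> {0<..<T}) (\<lambda>(x,t). action_density H x (?w x t) * s x t)"
    using sc unfolding split_beta
    by (intro continuous_intros continuous_on_compose2[OF continuous_on_action_density[OF H, unfolded split_beta], of _ "\<lambda>y. (fst y, ?w (fst y) (snd y))", simplified]
       continuous_on_spatial_grad[OF C21, unfolded split_beta]) auto
  have "A b - A a = integral {a..b} B"
  proof (rule du_bois_reymond[OF _ _ _ ab])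
    show "continuous_on {0<..<T} A" "continuous_on {0<..<T} B"
      unfolding A_def B_def by (intro cell_integral_continuous Ac Bc)+
    fix \<eta> \<eta>' :: "real \<Rightarrow> real" and a b
    assume \<eta>: "\<And>t. (\<eta> has_real_derivative \<eta>' t) (at t)" "continuous_on UNIV \<eta>'"
      and ab: "0 < a" "a < b" "b < T" and 0: "\<And>t. t \<notin> {a..b} \<Longrightarrow> \<eta> t = 0"
    note \<phi> = C21_on_time_mult[OF C21 \<eta>]
    have per: "periodic (\<lambda>x. \<eta> t * v x t)" if "t \<in> {0<..<T}" for t
      using vD(1)[of t] that by (simp add: periodic_def)
    have "0 = (LINT t:{0<..<T}|lborel. LINT x:unit_cell|lborel.
           s x t * (deriv (\<lambda>t. \<eta> t * v x t) t + grad (H x) (?w x t) \<bullet> grad (\<lambda>y. \<eta> t * v y t) x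
                    - \<epsilon> * laplacian (\<lambda>y. \<eta> t * v y t) x))"
      by (rule sD(3)[OF \<phi>(1) per ab, symmetric]) (use 0 in auto)
    also have "\<dots> = (LINT t:{0<..<T}|lborel. \<eta>' t * A t + \<eta> t * B t)"
    proof (rule set_lebesgue_integral_cong)
      show "\<forall>t. t \<in> {0<..<T} \<longrightarrow> (LINT x:unit_cell|lborel.
           s x t * (deriv (\<lambda>t. \<eta> t * v x t) t + grad (H x) (?w x t) \<bullet> grad (\<lambda>y. \<eta> t * v y t) x
                    - \<epsilon> * laplacian (\<lambda>y. \<eta> t * v y t) x)) = \<eta>' t * A t + \<eta> t * B t"
      proof (intro allI impI)
        fix t assume t: "t \<in> {0<..<T}"
        have "s x t * (deriv (\<lambda>t. \<eta> t * v x t) t + grad (H x) (?w x t) \<bullet> grad (\<lambda>y. \<eta> t * v y t) x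
               - \<epsilon> * laplacian (\<lambda>y. \<eta> t * v y t) x)
             = \<eta>' t * (v x t * s x t) + \<eta> t * (action_density H x (?w x t) * s x t)" for x
        proof -
          have eq: "deriv (v x) t = \<epsilon> * laplacian (\<lambda>y. v y t) x - H x (?w x t)"
            using vD(5)[of t x] t by simp
          show ?thesis
            unfolding \<phi>(2-4)[OF t] eq action_density_def by (simp add: algebra_simps)
        qed
        moreover note cell_integral(1)[OF continuous_on_slice[OF Ac t]]
          cell_integral(1)[OF continuous_on_slice[OF Bc t]]
        ultimately show "(LINT x:unit_cell|lborel.
           s x t * (deriv (\<lambda>t. \<eta> t * v x t) t + grad (H x) (?w x t) \<bullet> grad (\<lambda>y. \<eta> t * v y t) x
                    - \<epsilon> * laplacian (\<lambda>y. \<eta> t * v y t) x)) = \<eta>' t * A t + \<eta> t * B t"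
          by (simp add: A_def B_def set_integral_add)
      qed
    qed simp
    finally show "(LINT t:{0<..<T}|lborel. \<eta>' t * A t + \<eta> t * B t) = 0" by simp
  qed
  then show ?thesis unfolding A_def B_def .
qed

lemma lipschitz_in_time:
  fixes f :: "real \<Rightarrow> real"
  assumes f: "continuous_on {0..} f" and d: "\<And>t. t > 0 \<Longrightarrow> (f has_real_derivative f' t) (at t)"
    and b: "\<And>t. t > 0 \<Longrightarrow> \<bar>f' t\<bar> \<le> C" and st: "0 \<le> s" "s \<le> t"
  shows "\<bar>f t - f s\<bar> \<le> C * (t - s)"
proof (cases "s = t")
  case False
  then have "s < t" using st by simp
  moreover have "continuous_on {s..t} f" using f by (rule continuous_on_subset) (use st in auto)
  moreover have "(f has_derivative (\<lambda>h. h * f' x)) (at x)" if "s < x" for x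
    using d[of x] that st by (simp add: has_field_derivative_def mult_commute_abs)
  ultimately obtain \<xi> where "s < \<xi>" "f t - f s = (t - s) * f' \<xi>"
    using mvt[of s t f "\<lambda>x h. h * f' x"] by metis
  then show ?thesis
    using b[of \<xi>] st \<open>s < t\<close> by (auto simp: abs_mult mult.commute intro!: mult_left_mono)
qed simp

text \<open>
  The balance law is integrated over \<open>[l\<^sub>n, r\<^sub>n]\<close>, which exhausts \<open>(0,T)\<close>.  At the upper end \<open>v\<close>
  is first frozen at time \<open>T\<close>, which costs at most \<open>C (T - r\<^sub>n)\<close> because \<open>\<sigma>\<close> is a probability density;
  the frozen function is an admissible test function for the terminal condition.
\<close>

lemma duality_representation:
  fixes H :: "real^'n \<Rightarrow> real^'n \<Rightarrow> real"
  assumes H: "C2_on UNIV (\<lambda>(x,p). H x p)" "\<And>p. periodic (\<lambda>x. H x p)"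
    and v: "viscous_solution \<epsilon> H g v"
    and bound: "\<And>x t y r. t > 0 \<Longrightarrow> r > 0 \<Longrightarrow>
          \<bar>deriv (v x) t\<bar> + norm (grad (\<lambda>w. v w r) y) \<le> C"
    and T: "T > 0"
    and s: "adjoint_solution \<epsilon> H v z T s"
    and s_nonneg: "\<And>x t. t \<in> {0..<T} \<Longrightarrow> s x t \<ge> 0"
    and \<nu>: "\<And>t. t \<in> {0..<T} \<Longrightarrow> nu_measure C (grad (\<lambda>x. v x t)) (\<lambda>x. s x t) (\<nu> t)"
  shows "v z T = (LINT x:unit_cell|lborel. g x * s x 0)
     + (LINT t:{0..T}|lborel. LINT (x,p)|\<nu> t. action_density H x p)"
proof -
  note vD = viscous_solutionD[OF v] and sD = adjoint_solutionD[OF s]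
  define A where "A t = (LINT x:unit_cell|lborel. v x t * s x t)" for t
  define B where "B t = (LINT (x,p)|\<nu> t. action_density H x p)" for t
  have B_eq: "B t = (LINT x:unit_cell|lborel. action_density H x (grad (\<lambda>y. v y t) x) * s x t)"
    if "t \<in> {0..<T}" for t
    unfolding B_def
    by (rule nu_measureD(4)[OF \<nu>[OF that]])
      (intro continuous_on_action_density periodic_action_density H)+
  have mass: "(LINT x:unit_cell|lborel. s x t) = 1" if "t \<in> {0..<T}" for t
  proof -
    interpret N: prob_space "\<nu> t" by (rule nu_measureD(1)[OF \<nu>[OF that]])
    show ?thesis
      using nu_measureD(4)[OF \<nu>[OF that], of "\<lambda>_ _. 1"] by (simp add: periodic_def N.prob_space split_def)
  qed
  have Bc: "continuous_on {0<..<T} B"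
    unfolding B_def
    by (rule continuous_on_nu_integral[OF vD(3) sD(2) _ _ \<nu>])
      (intro continuous_on_action_density periodic_action_density H | assumption)+
  obtain b where b: "\<And>x p :: real^'n. x \<in> unit_cell \<Longrightarrow> norm p \<le> C \<Longrightarrow> \<bar>action_density H x p\<bar> \<le> b"
    using bounded_on_cell_times_cball[OF continuous_on_action_density[OF H(1)], of C] by blast
  have Bb: "\<bar>B t\<bar> \<le> b" if "t \<in> {0..<T}" for t
  proof -
    interpret N: prob_space "\<nu> t" by (rule nu_measureD(1)[OF \<nu>[OF that]])
    have AE: "AE y in \<nu> t. \<bar>case y of (x, p) \<Rightarrow> action_density H x p\<bar> \<le> b"
      using nu_measureD(3)[OF \<nu>[OF that]] by eventually_elim (auto intro: b)
    have "(\<lambda>(x,p). action_density H x p) \<in> borel_measurable (\<nu> t)"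
      unfolding measurable_cong_sets[OF nu_measureD(2)[OF \<nu>[OF that]] refl]
      by (rule borel_measurable_continuous_onI[OF continuous_on_action_density[OF H(1)]])
    then have "integrable (\<nu> t) (\<lambda>(x,p). action_density H x p)"
      by (rule N.integrable_const_bound[rotated]) (use AE in simp)
    moreover have "AE y in \<nu> t. (case y of (x, p) \<Rightarrow> action_density H x p) \<le> b"
      "AE y in \<nu> t. - b \<le> (case y of (x, p) \<Rightarrow> action_density H x p)"
      using AE by (eventually_elim; linarith)+
    ultimately show "\<bar>B t\<bar> \<le> b"
      unfolding B_def using N.integral_le_const N.integral_ge_const by (auto simp: abs_le_iff minus_le_iff)
  qed
  have Ac: "continuous_on {0..<T} A"
    unfolding A_def
  proof (rule cell_integral_continuous)
    show "continuous_on (UNIV \<times> {0..<T}) (\<lambda>(x,t). v x t * s x t)"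
      using sD(2) continuous_on_subset[OF vD(2), of "UNIV \<times> {0..<T}"] unfolding split_beta
      by (force intro!: continuous_intros)
  qed
  \<comment> \<open>The offset \<open>3\<close> makes \<open>l n < r n\<close> hold from \<open>n = 0\<close> on.\<close>
  define l where "l n = T / real (n + 3)" for n
  define r where "r n = T - l n" for n
  have l: "0 < l n" "l n < r n" "r n < T" for n
  proof -
    have "l n \<le> T / 3" unfolding l_def using T by (intro divide_left_mono) auto
    moreover have "0 < l n" unfolding l_def using T by simp
    ultimately show "0 < l n" "l n < r n" "r n < T" unfolding r_def using T by linarith+
  qed
  have l0: "l \<longlonglongrightarrow> 0"
    unfolding l_def using T by real_asymp
  then have rT: "r \<longlonglongrightarrow> T"
    unfolding r_def by (auto intro!: tendsto_eq_intros)
  have A_l: "(\<lambda>n. A (l n)) \<longlonglongrightarrow> A 0"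
    by (rule continuous_on_tendsto_compose[OF Ac l0]) (use T l in \<open>auto intro!: always_eventually less_imp_le intro: less_trans\<close>)
  have A_r: "(\<lambda>n. A (r n)) \<longlonglongrightarrow> v z T"
  proof -
    have vT: "continuous_on UNIV (\<lambda>x. v x T)" by (rule continuous_on_slice[OF vD(2)]) (use T in simp)
    have "filterlim r (at_left T) sequentially"
      using rT l(3) by (auto simp: filterlim_at intro!: always_eventually)
    then have 1: "(\<lambda>n. LINT x:unit_cell|lborel. v x T * s x (r n)) \<longlonglongrightarrow> v z T"
      using T by (intro filterlim_compose[OF sD(4)[OF vT vD(1)]]) auto
    have diff: "\<bar>A (r n) - (LINT x:unit_cell|lborel. v x T * s x (r n))\<bar> \<le> C * (T - r n)" for n
    proof -
      have r: "r n \<in> {0..<T}" "r n \<in> {0..}" using l(1,2,3)[of n] by auto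
      have sc: "continuous_on UNIV (\<lambda>x. s x (r n))" by (rule continuous_on_slice[OF sD(2) r(1)])
      have vr: "continuous_on UNIV (\<lambda>x. v x (r n))" by (rule continuous_on_slice[OF vD(2) r(2)])
      have lip: "\<bar>v x T - v x (r n)\<bar> \<le> C * (T - r n)" for x
      proof (rule lipschitz_in_time)
        show "continuous_on {0..} (v x)"
          by (rule continuous_on_compose2[OF vD(2), of _ "\<lambda>t. (x,t)", simplified]) (auto intro!: continuous_intros)
        show "(v x has_real_derivative deriv (v x) t) (at t)" "\<bar>deriv (v x) t\<bar> \<le> C" if "t > 0" for t
        proof -
          show "(v x has_real_derivative deriv (v x) t) (at t)"
            using vD(3) that unfolding C21_on_def by (metis DERIV_imp_deriv greaterThan_iff)
          show "\<bar>deriv (v x) t\<bar> \<le> C"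
            using bound[OF that that, of x x] norm_ge_zero[of "grad (\<lambda>w. v w t) x"] by linarith
        qed
      qed (use r in auto)
      note i1 = cell_integral(1)[OF continuous_on_mult[OF vr sc]]
        and i2 = cell_integral(1)[OF continuous_on_mult[OF vT sc]]
      have "\<bar>A (r n) - (LINT x:unit_cell|lborel. v x T * s x (r n))\<bar>
          = \<bar>LINT x:unit_cell|lborel. v x (r n) * s x (r n) - v x T * s x (r n)\<bar>"
        unfolding A_def using i1 i2 by (simp add: set_integral_diff)
      also have "\<dots> \<le> (LINT x:unit_cell|lborel. C * (T - r n) * s x (r n))"
        unfolding set_lebesgue_integral_def
      proof (rule integral_abs_bound_integral)
        show "integrable lborel (\<lambda>x. indicator unit_cell x *\<^sub>R (v x (r n) * s x (r n) - v x T * s x (r n)))"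
          using set_integral_diff(1)[OF i1 i2] by (simp add: set_integrable_def)
        show "integrable lborel (\<lambda>x. indicator unit_cell x *\<^sub>R (C * (T - r n) * s x (r n)))"
          using cell_integral(1)[OF continuous_on_mult[OF continuous_on_const sc]]
          by (simp add: set_integrable_def)
        show "\<bar>indicator unit_cell x *\<^sub>R (v x (r n) * s x (r n) - v x T * s x (r n))\<bar>
            \<le> indicator unit_cell x *\<^sub>R (C * (T - r n) * s x (r n))" for x
          using mult_right_mono[OF lip[of x] s_nonneg[OF r(1), of x]] s_nonneg[OF r(1), of x]
          by (auto simp: indicator_def left_diff_distrib[symmetric] abs_mult abs_minus_commute)
      qed
      also have "\<dots> = C * (T - r n)" using mass[OF r(1)] by simp
      finally show ?thesis .
    qed
    have "(\<lambda>n. A (r n) - (LINT x:unit_cell|lborel. v x T * s x (r n))) \<longlonglongrightarrow> 0"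
    proof (rule Lim_null_comparison)
      show "(\<lambda>n. C * (T - r n)) \<longlonglongrightarrow> 0" using rT by (auto intro!: tendsto_eq_intros)
    qed (simp add: diff)
    from tendsto_add[OF this 1] show ?thesis by simp
  qed
  have Bm: "set_borel_measurable lborel {0<..<T} B"
    unfolding set_borel_measurable_def
    using borel_measurable_continuous_on_indicator[OF _ Bc] by simp
  have "(\<lambda>n. LINT t:{l n..r n}|lborel. B t) \<longlonglongrightarrow> (LINT t:{0<..<T}|lborel. B t)"
    unfolding set_lebesgue_integral_def
  proof (rule integral_dominated_convergence)
    show "integrable lborel (\<lambda>t. indicator {0<..<T} t * b)" by (simp add: T less_imp_le)
    show "(\<lambda>t. indicator {0<..<T} t *\<^sub>R B t) \<in> borel_measurable lborel"
      using Bm by (simp add: set_borel_measurable_def)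
    show "(\<lambda>t. indicator {l n..r n} t *\<^sub>R B t) \<in> borel_measurable lborel" for n
    proof -
      have "continuous_on {l n..r n} B" by (rule continuous_on_subset[OF Bc]) (use l[of n] in auto)
      then show ?thesis using borel_measurable_continuous_on_indicator[of "{l n..r n}" B] by simp
    qed
    show "AE t in lborel. norm (indicator {l n..r n} t *\<^sub>R B t) \<le> indicator {0<..<T} t * b" for n
      using l[of n] Bb order_trans[OF abs_ge_zero Bb[of 0]] T by (auto simp: indicator_def intro!: AE_I2)
    show "AE t in lborel. (\<lambda>n. indicator {l n..r n} t *\<^sub>R B t) \<longlonglongrightarrow> indicator {0<..<T} t *\<^sub>R B t"
    proof (intro AE_I2)
      fix t
      show "(\<lambda>n. indicator {l n..r n} t *\<^sub>R B t) \<longlonglongrightarrow> indicator {0<..<T} t *\<^sub>R B t"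
      proof (cases "t \<in> {0<..<T}")
        case True
        then have "eventually (\<lambda>n. l n < t) sequentially" "eventually (\<lambda>n. t < r n) sequentially"
          using order_tendstoD(2)[OF l0] order_tendstoD(1)[OF rT] by auto
        then have "eventually (\<lambda>n. indicator {l n..r n} t *\<^sub>R B t = indicator {0<..<T} t *\<^sub>R B t) sequentially"
          by eventually_elim (use True in auto)
        then show ?thesis by (rule tendsto_eventually)
      next
        case False
        then have "indicator {l n..r n} t = (0::real)" for n using l[of n] by (auto simp: indicator_def)
        with False show ?thesis by simp
      qed
    qed
  qed
  moreover have "(LINT t:{l n..r n}|lborel. B t) = A (r n) - A (l n)" for n
  proof -
    have c: "continuous_on {l n..r n} B" by (rule continuous_on_subset[OF Bc]) (use l[of n] in auto)
    have "(LINT t:{l n..r n}|lborel. B t) = integral {l n..r n} B"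
      by (rule set_borel_integral_eq_integral(2)[OF borel_integrable_atLeastAtMost'[OF c]])
    also have "\<dots> = integral {l n..r n}
        (\<lambda>t. LINT x:unit_cell|lborel. action_density H x (grad (\<lambda>y. v y t) x) * s x t)"
      by (intro integral_cong B_eq) (use l[of n] in auto)
    also have "\<dots> = A (r n) - A (l n)"
      unfolding A_def by (rule adjoint_balance[OF H(1) v s l, symmetric])
    finally show ?thesis .
  qed
  ultimately have "(\<lambda>n. A (r n) - A (l n)) \<longlonglongrightarrow> (LINT t:{0<..<T}|lborel. B t)" by simp
  with tendsto_diff[OF A_r A_l] have "v z T - A 0 = (LINT t:{0<..<T}|lborel. B t)"
    using LIMSEQ_unique by blast
  also have "\<dots> = (LINT t:{0..T}|lborel. B t)"
    unfolding set_lebesgue_integral_def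
    by (rule integral_discrete_difference[where X="{0,T}"]) (auto simp: indicator_def)
  finally show ?thesis by (simp add: A_def B_def vD(4))
qed

text \<open>
  The time interval is opened up, so that \<open>\<nu>\<^sub>t\<close> is a probability measure for every \<open>t\<close>
  considered and its integrals depend continuously on \<open>t\<close>; the two endpoints are Lebesgue null.
\<close>

lemma occupation_integral:
  fixes \<nu> :: "real \<Rightarrow> ((real^'n) \<times> (real^'n)) measure"
  assumes M: "mu_measure C T \<nu> M"
    and \<nu>: "\<And>t. t \<in> {0..<T} \<Longrightarrow> nu_measure C (w t) (s t) (\<nu> t)"
    and \<psi>: "continuous_on UNIV (\<lambda>(x,p). \<psi> x p :: real)"
    and cont: "continuous_on {0<..<T} (\<lambda>t. LINT (x,p)|\<nu> t. \<psi> x p)"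
  shows "(LINT (x,p,t)|M. \<psi> x p) = (LINT t:{0..T}|lborel. LINT (x,p)|\<nu> t. \<psi> x p)"
proof -
  have Mfin: "finite_measure M" and Msets: "sets M = sets borel"
    and MK: "AE y in M. y \<in> unit_cell \<times> cball 0 C \<times> {0..T}"
    and Meq: "\<And>A. A \<in> sets borel \<Longrightarrow>
      emeasure M A = (\<integral>\<^sup>+t\<in>{0..T}. emeasure (\<nu> t) {(x,p). (x,p,t) \<in> A} \<partial>lborel)"
    using M unfolding mu_measure_def finite_borel_measure_on_def by blast+
  let ?L = "restrict_space lborel {0<..<T}"
  let ?j = "\<lambda>t (x,p). (x,p,t) :: (real^'n) \<times> (real^'n) \<times> real"
  have spL: "t \<in> {0..<T}" if "t \<in> space ?L" for t using that by (auto simp: space_restrict_space)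
  obtain b where b: "\<And>x p :: real^'n. x \<in> unit_cell \<Longrightarrow> norm p \<le> C \<Longrightarrow> \<bar>\<psi> x p\<bar> \<le> b"
    using bounded_on_cell_times_cball[OF \<psi>, of C] by blast
  have jm: "?j t \<in> measurable (\<nu> t) M" if "t \<in> space ?L" for t
    unfolding measurable_cong_sets[OF nu_measureD(2)[OF \<nu>[OF spL[OF that]]] Msets] split_beta
    by (intro borel_measurable_continuous_onI continuous_intros)
  have "(LINT y|M. (case y of (x,p,t) \<Rightarrow> \<psi> x p)) = (LINT t|?L. LINT y|\<nu> t. (case ?j t y of (x,p,t) \<Rightarrow> \<psi> x p))"
  proof (rule integral_eq_iterated[where b = b])
    show "finite_measure M" by fact
    show "finite_measure ?L"
      by (rule finite_measureI, cases "0 \<le> T") (auto simp: space_restrict_space emeasure_restrict_space)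
    show "prob_space (\<nu> t)" if "t \<in> space ?L" for t by (rule nu_measureD(1)[OF \<nu>[OF spL[OF that]]])
    show "?j t \<in> measurable (\<nu> t) M" if "t \<in> space ?L" for t by (rule jm[OF that])
    show "emeasure M A = (\<integral>\<^sup>+t. (\<integral>\<^sup>+y. indicator A (?j t y) \<partial>\<nu> t) \<partial>?L)" if A: "A \<in> sets M" for A
    proof -
      have "emeasure M A = (\<integral>\<^sup>+t\<in>{0..T}. emeasure (\<nu> t) {(x,p). (x,p,t) \<in> A} \<partial>lborel)"
        using A by (intro Meq) (simp add: Msets)
      also have "\<dots> = (\<integral>\<^sup>+t\<in>{0<..<T}. emeasure (\<nu> t) {(x,p). (x,p,t) \<in> A} \<partial>lborel)"
      proof (rule nn_integral_cong_AE)
        show "AE t in lborel. emeasure (\<nu> t) {(x,p). (x,p,t) \<in> A} * indicator {0..T} t =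
            emeasure (\<nu> t) {(x,p). (x,p,t) \<in> A} * indicator {0<..<T} t"
          using AE_lborel_singleton[of 0] AE_lborel_singleton[of T]
          by eventually_elim (auto simp: indicator_def)
      qed
      also have "\<dots> = (\<integral>\<^sup>+t. emeasure (\<nu> t) {(x,p). (x,p,t) \<in> A} \<partial>?L)"
        by (subst nn_integral_restrict_space) auto
      also have "\<dots> = (\<integral>\<^sup>+t. (\<integral>\<^sup>+y. indicator A (?j t y) \<partial>\<nu> t) \<partial>?L)"
      proof (rule nn_integral_cong)
        fix t assume t: "t \<in> space ?L"
        have sp: "space (\<nu> t) = UNIV"
          using sets_eq_imp_space_eq[OF nu_measureD(2)[OF \<nu>[OF spL[OF t]]]] by simp
        have "{(x,p). (x,p,t) \<in> A} \<in> sets (\<nu> t)"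
          using measurable_sets[OF jm[OF t] A] sp by (simp add: vimage_def split_def)
        then have "emeasure (\<nu> t) {(x,p). (x,p,t) \<in> A} = (\<integral>\<^sup>+y. indicator {(x,p). (x,p,t) \<in> A} y \<partial>\<nu> t)"
          by simp
        also have "\<dots> = (\<integral>\<^sup>+y. indicator A (?j t y) \<partial>\<nu> t)"
          by (intro nn_integral_cong) (auto simp: indicator_def)
        finally show "emeasure (\<nu> t) {(x,p). (x,p,t) \<in> A} = (\<integral>\<^sup>+y. indicator A (?j t y) \<partial>\<nu> t)" .
      qed
      finally show ?thesis .
    qed
    show "(\<lambda>(x,p,t). \<psi> x p) \<in> borel_measurable M"
      unfolding measurable_cong_sets[OF Msets refl] split_beta
      by (intro borel_measurable_continuous_onI continuous_on_compose2[OF \<psi>[unfolded split_beta], of _ "\<lambda>y. (fst y, fst (snd y))", simplified] continuous_intros)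
    show "AE y in M. \<bar>case y of (x,p,t) \<Rightarrow> \<psi> x p\<bar> \<le> b"
      using MK by eventually_elim (auto intro: b)
    show "AE y in \<nu> t. \<bar>case ?j t y of (x,p,t) \<Rightarrow> \<psi> x p\<bar> \<le> b" if "t \<in> space ?L" for t
      using nu_measureD(3)[OF \<nu>[OF spL[OF that]]] by eventually_elim (auto intro: b)
    have "(\<lambda>t. LINT (x,p)|\<nu> t. \<psi> x p) \<in> borel_measurable ?L"
      using borel_measurable_continuous_on_restrict[OF cont]
      by (simp cong: measurable_cong_sets add: sets_restrict_space)
    then show "(\<lambda>t. LINT y|\<nu> t. (case ?j t y of (x,p,t) \<Rightarrow> \<psi> x p)) \<in> borel_measurable ?L"
      by (simp add: split_def)
  qed
  also have "\<dots> = (LINT t:{0<..<T}|lborel. LINT (x,p)|\<nu> t. \<psi> x p)"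
    by (simp add: integral_restrict_space set_lebesgue_integral_def split_def)
  also have "\<dots> = (LINT t:{0..T}|lborel. LINT (x,p)|\<nu> t. \<psi> x p)"
    unfolding set_lebesgue_integral_def
    by (rule integral_discrete_difference[where X="{0,T}"]) (auto simp: indicator_def)
  finally show ?thesis .
qed

section \<open>Vanishing viscosity\<close>

text \<open>
  Periodicity transports the bound on the derivative from the compact cell to the whole space.
\<close>

lemma lipschitz_in_position:
  fixes H :: "real^'n \<Rightarrow> real^'n \<Rightarrow> real"
  assumes H: "C2_on UNIV (\<lambda>(x,p). H x p)" and per: "\<And>p. periodic (\<lambda>x. H x p)"
  obtains L where "L \<ge> 0"
    "\<And>x y p. norm p \<le> C \<Longrightarrow> \<bar>H x p - H y p\<bar> \<le> L * norm (x - y)"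
proof -
  obtain f' where f: "\<And>y. ((\<lambda>(x,p). H x p) has_derivative blinfun_apply (f' y)) (at y)"
      "continuous_on UNIV f'"
    using C2_on_imp_C1[OF H] by blast
  have "compact (f' ` (closed_cell \<times> cball 0 C))"
    by (intro compact_continuous_image compact_Times compact_cbox compact_cball
        continuous_on_subset[OF f(2)]) auto
  then obtain L where L: "L > 0" "\<And>y. y \<in> closed_cell \<times> cball 0 C \<Longrightarrow> norm (f' y) \<le> L"
    using compact_imp_bounded bounded_pos by (metis (no_types, lifting) imageI)
  have *: "\<exists>D. ((\<lambda>y. H y p) has_derivative D) (at x) \<and> onorm D \<le> L" if p: "norm p \<le> C" for x p
  proof -
    obtain k :: "real^'n" where k: "\<And>i. k $ i \<in> \<int>" "x + k \<in> unit_cell"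
      using ex_shift_to_unit_cell[of x] by blast
    let ?D = "\<lambda>h. f' (x + k, p) (h, 0)"
    have "((\<lambda>y. (\<lambda>(x,p). H x p) (y, p)) has_derivative ?D) (at (x + k))"
      by (rule has_derivative_compose[OF _ f(1)]) (auto intro!: derivative_eq_intros)
    then have "((\<lambda>y. H y p) has_derivative ?D) (at (x + k))" by simp
    then have "((\<lambda>y. H y p) has_derivative ?D) (at (x + k + (- k)))"
      by (rule has_derivative_periodic_shift[OF per, rotated]) (use k(1) in simp)
    moreover have "onorm ?D \<le> L"
    proof (rule onorm_le)
      fix h
      have "norm (f' (x + k, p) (h, 0)) \<le> norm (f' (x + k, p)) * norm (h, 0::real^'n)"
        by (rule norm_blinfun)
      also have "\<dots> \<le> L * norm h"
        using L(1) L(2)[of "(x + k, p)"] k(2) p unit_cell_subset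
        by (intro mult_mono) (auto simp: norm_Pair)
      finally show "norm (f' (x + k, p) (h, 0)) \<le> L * norm h" .
    qed
    ultimately show ?thesis by auto
  qed
  show thesis
  proof
    fix x y p :: "real^'n" assume p: "norm p \<le> C"
    obtain D where "\<And>x. ((\<lambda>y. H y p) has_derivative D x) (at x)" "\<And>x. onorm (D x) \<le> L"
      using *[OF p] by metis
    then show "\<bar>H x p - H y p\<bar> \<le> L * norm (x - y)"
      using differentiable_bound[of UNIV "\<lambda>y. H y p" D L x y] by simp
  qed (use L in simp)
qed

lemma lipschitz_in_space:
  fixes f :: "real^'n \<Rightarrow> real"
  assumes d: "\<And>x. (f has_derivative f' x) (at x)" and b: "\<And>x. norm (grad f x) \<le> C"
  shows "\<bar>f x - f y\<bar> \<le> C * norm (x - y)"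
proof -
  have "onorm (f' x) \<le> C" for x
  proof (rule onorm_le)
    fix h
    have "norm (f' x h) \<le> norm h * norm (grad f x)"
      unfolding has_derivative_imp_grad(2)[OF d] real_norm_def by (rule Cauchy_Schwarz_ineq2)
    also have "\<dots> \<le> C * norm h" using mult_right_mono[OF b[of x], of "norm h"] by (simp add: mult.commute)
    finally show "norm (f' x h) \<le> C * norm h" .
  qed
  then show ?thesis
    using differentiable_bound[of UNIV f f' C x y] d by simp
qed

lemma second_derivative_nonneg_at_min:
  fixes h :: "real \<Rightarrow> real"
  assumes h: "\<And>r. (h has_real_derivative h' r) (at r)" and h': "(h' has_real_derivative c) (at 0)"
    and min: "\<And>r. h 0 \<le> h r"
  shows "h' 0 = 0" "c \<ge> 0"
proof -
  show 0: "h' 0 = 0"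
    by (rule DERIV_local_min[OF h, of 1]) (use min in auto)
  show "c \<ge> 0"
  proof (rule ccontr)
    assume "\<not> c \<ge> 0"
    then obtain d where d: "d > 0" "\<And>r. 0 < r \<Longrightarrow> r < d \<Longrightarrow> h' r < 0"
      using has_real_derivative_neg_dec_right[OF h'] 0 by auto
    have "\<exists>r. 0 < r \<and> r < d / 2 \<and> h (d/2) - h 0 = (d/2 - 0) * h' r"
      by (rule MVT2) (use d(1) h in auto)
    then obtain r where "0 < r" "r < d / 2" "h (d/2) - h 0 = d/2 * h' r" by auto
    then have "h (d/2) < h 0" using d(1) d(2)[of r] mult_pos_neg[of "d/2" "h' r"] by auto
    with min[of "d/2"] show False by simp
  qed
qed

text \<open>
  The information that doubling gives on the smooth function: along each coordinate axis,
  \<open>f\<close> plus a parabola of second derivative \<open>1/\<delta>\<close> has a minimum, so the second derivative of \<open>f\<close> there is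
  at least \<open>-1/\<delta>\<close>.
\<close>

lemma derivatives_at_quadratic_touching:
  fixes f :: "real^'n \<Rightarrow> real"
    and D1 :: "real^'n \<Rightarrow> (real^'n) \<Rightarrow>\<^sub>L real" and D2 :: "(real^'n) \<Rightarrow>\<^sub>L (real^'n) \<Rightarrow>\<^sub>L real"
  assumes D1: "\<And>y. (f has_derivative D1 y) (at y)" and D2: "(D1 has_derivative D2) (at y0)"
    and \<delta>: "\<delta> > 0"
    and min: "\<And>y. f y0 + (norm (x0 - y0))\<^sup>2 / (2 * \<delta>) \<le> f y + (norm (x0 - y))\<^sup>2 / (2 * \<delta>)"
  shows "grad f y0 = (1 / \<delta>) *\<^sub>R (x0 - y0)" "laplacian f y0 \<ge> - real CARD('n) / \<delta>"
proof -
  have touch: "D1 y0 (axis i 1) - (x0 - y0) $ i / \<delta> = 0 \<and> D2 (axis i 1) (axis i 1) + 1 / \<delta> \<ge> 0" for i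
  proof -
    let ?e = "axis i (1::real) :: real^'n"
    define h where "h r = f (y0 + r *\<^sub>R ?e) + (r\<^sup>2 - 2 * r * (x0 - y0) $ i) / (2 * \<delta>)" for r
    define h' where "h' r = D1 (y0 + r *\<^sub>R ?e) ?e + (r - (x0 - y0) $ i) / \<delta>" for r
    have line: "((\<lambda>r. y0 + r *\<^sub>R ?e) has_derivative (\<lambda>k. k *\<^sub>R ?e)) (at r)" for r
      by (auto intro!: derivative_eq_intros)
    have 1: "(h has_real_derivative h' r) (at r)" for r
    proof -
      have "((\<lambda>r. f (y0 + r *\<^sub>R ?e)) has_derivative (\<lambda>k. D1 (y0 + r *\<^sub>R ?e) (k *\<^sub>R ?e))) (at r)"
        by (rule has_derivative_compose[OF line D1])
      then have "((\<lambda>r. f (y0 + r *\<^sub>R ?e)) has_real_derivative D1 (y0 + r *\<^sub>R ?e) ?e) (at r)"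
        by (simp add: has_field_derivative_def blinfun.scaleR_right mult_commute_abs)
      then show ?thesis
        unfolding h_def[abs_def] h'_def using \<delta> by (auto intro!: derivative_eq_intros simp: field_simps)
    qed
    have "((\<lambda>r. D1 (y0 + r *\<^sub>R ?e)) has_derivative (\<lambda>k. D2 (k *\<^sub>R ?e))) (at 0)"
      by (rule has_derivative_compose[OF line]) (use D2 in simp)
    then have "((\<lambda>r. D1 (y0 + r *\<^sub>R ?e) ?e) has_derivative (\<lambda>k. D2 (k *\<^sub>R ?e) ?e)) (at 0)"
      by (rule bounded_linear.has_derivative[OF blinfun.bounded_linear_left])
    then have "((\<lambda>r. D1 (y0 + r *\<^sub>R ?e) ?e) has_real_derivative D2 ?e ?e) (at 0)"
      by (simp add: has_field_derivative_def blinfun.scaleR_right blinfun.scaleR_left mult_commute_abs)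
    then have 2: "(h' has_real_derivative D2 ?e ?e + 1 / \<delta>) (at 0)"
      unfolding h'_def[abs_def] using \<delta> by (auto intro!: derivative_eq_intros)
    have 3: "h 0 \<le> h r" for r
    proof -
      have "(norm (x0 - (y0 + r *\<^sub>R ?e)))\<^sup>2 = (norm (x0 - y0))\<^sup>2 + (r\<^sup>2 - 2 * r * (x0 - y0) $ i)"
        unfolding power2_norm_eq_inner
        by (simp add: inner_diff_left inner_diff_right inner_add_left inner_add_right inner_axis inner_axis'
            inner_commute power2_eq_square algebra_simps)
      with min[of "y0 + r *\<^sub>R ?e"] show ?thesis
        by (simp add: h_def add_divide_distrib)
    qed
    show ?thesis
      using second_derivative_nonneg_at_min[OF 1 2 3] by (simp add: h'_def diff_divide_distrib)
  qed
  have *: "D1 y0 (axis i 1) = (x0 - y0) $ i / \<delta>" "D2 (axis i 1) (axis i 1) \<ge> - 1 / \<delta>" for i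
    using conjunct1[OF touch[of i]] conjunct2[OF touch[of i]] by (simp, simp add: minus_divide_left[symmetric])
  show "grad f y0 = (1 / \<delta>) *\<^sub>R (x0 - y0)"
    using has_derivative_imp_grad(1)[OF D1] *(1) by (simp add: vec_eq_iff)
  have "(\<Sum>i\<in>(UNIV::'n set). - 1 / \<delta>) \<le> (\<Sum>i\<in>UNIV. D2 (axis i 1) (axis i 1))"
    by (intro sum_mono *(2))
  then show "laplacian f y0 \<ge> - real CARD('n) / \<delta>"
    using laplacian_eq[OF D1 D2] by simp
qed

text \<open>
  The test functions used for the viscosity solution at a maximum of the doubled functional.
\<close>

lemma separated_test_function:
  fixes c :: "real^'n" and a a' :: "real \<Rightarrow> real"
  assumes a: "\<And>t. t > 0 \<Longrightarrow> (a has_real_derivative a' t) (at t)" "continuous_on {0<..} a'"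
    and \<delta>: "\<delta> > 0"
  defines "\<phi> \<equiv> \<lambda>x t. a t + (norm (x - c))\<^sup>2 / (2 * \<delta>)"
  shows "C1_on (UNIV \<times> {0<..}) (\<lambda>(x,t). \<phi> x t)"
    and "t > 0 \<Longrightarrow> deriv (\<phi> x) t = a' t"
    and "grad (\<lambda>x. \<phi> x t) x = (1 / \<delta>) *\<^sub>R (x - c)"
proof -
  have \<phi>: "\<phi> x t = a t + (x - c) \<bullet> (x - c) / (2 * \<delta>)" for x t
    by (simp add: \<phi>_def power2_norm_eq_inner)
  define F :: "(real^'n) \<times> real \<Rightarrow> ((real^'n) \<times> real) \<Rightarrow>\<^sub>L real" where
    "F y = a' (snd y) *\<^sub>R snd_blinfun + (1 / \<delta>) *\<^sub>R (blinfun_inner_right (fst y - c) o\<^sub>L fst_blinfun)" for y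
  have F_apply: "F y h = a' (snd y) * snd h + (1 / \<delta>) * ((fst y - c) \<bullet> fst h)" for y h
    by (simp add: F_def blinfun.add_left blinfun.scaleR_left blinfun_inner_right.rep_eq)
  have "((\<lambda>(x,t). \<phi> x t) has_derivative F y) (at y)" if "snd y > 0" for y
  proof -
    have "((\<lambda>y. a (snd y)) has_derivative (\<lambda>h. snd h * a' (snd y))) (at y)"
      using a(1)[OF that] unfolding has_field_derivative_def
      by (intro has_derivative_compose[OF has_derivative_snd[OF has_derivative_ident], of a "\<lambda>h. h * a' (snd y)"])
        (simp add: mult_commute_abs)
    then have "((\<lambda>y. a (snd y) + (fst y - c) \<bullet> (fst y - c) / (2 * \<delta>)) has_derivative F y) (at y)"
      using \<delta> by (auto intro!: derivative_eq_intros simp: F_apply inner_commute field_simps fun_eq_iff)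
    then show ?thesis by (simp add: \<phi> split_def)
  qed
  moreover have "continuous_on (UNIV \<times> {0<..}) F"
    unfolding F_def[abs_def]
    by (intro continuous_intros continuous_on_compose2[OF a(2)]
        bounded_linear.continuous_on[OF bounded_linear_blinfun_inner_right]) auto
  ultimately show "C1_on (UNIV \<times> {0<..}) (\<lambda>(x,t). \<phi> x t)"
    unfolding C1_on_def by (intro exI[of _ F]) auto
  show "deriv (\<phi> x) t = a' t" if "t > 0"
    unfolding \<phi>_def using a(1)[OF that] by (intro DERIV_imp_deriv) (auto intro!: derivative_eq_intros)
  show "grad (\<lambda>x. \<phi> x t) x = (1 / \<delta>) *\<^sub>R (x - c)"
  proof (rule grad_eqI)
    have "((\<lambda>x. a t + (x - c) \<bullet> (x - c) / (2 * \<delta>)) has_derivative (\<lambda>h. h \<bullet> (x - c) / \<delta>)) (at x)"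
      using \<delta> by (auto intro!: derivative_eq_intros simp: inner_commute field_simps)
    then show "((\<lambda>x. \<phi> x t) has_derivative (\<lambda>h. h \<bullet> ((1 / \<delta>) *\<^sub>R (x - c)))) (at x)"
      by (simp add: \<phi>)
  qed
qed

lemma periodic_shift: "periodic f \<Longrightarrow> (\<And>i. k $ i \<in> \<int>) \<Longrightarrow> f (x + k) = f x"
  by (simp add: periodic_def)

lemma periodic_continuous_bounded:
  fixes w :: "real^'n \<Rightarrow> real \<Rightarrow> real"
  assumes "continuous_on (UNIV \<times> {0..}) (\<lambda>(x,t). w x t)" "\<And>t. t \<ge> 0 \<Longrightarrow> periodic (\<lambda>x. w x t)"
  obtains M where "\<And>x t. t \<in> {0..R} \<Longrightarrow> \<bar>w x t\<bar> \<le> M"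
proof -
  have "compact ((\<lambda>(x,t). w x t) ` (closed_cell \<times> {0..R}))"
    by (intro compact_continuous_image compact_Times compact_cbox compact_Icc
        continuous_on_subset[OF assms(1)]) auto
  then obtain M where M: "\<And>y. y \<in> (\<lambda>(x,t). w x t) ` (closed_cell \<times> {0..R}) \<Longrightarrow> norm y \<le> M"
    using compact_imp_bounded bounded_pos by (metis (no_types, lifting))
  have "\<bar>w x t\<bar> \<le> M" if "t \<in> {0..R}" for x t
  proof -
    obtain k where k: "\<And>i. k $ i \<in> \<int>" "x + k \<in> unit_cell" using ex_shift_to_unit_cell[of x] by blast
    have "w (x + k) t = w x t" using periodic_shift[OF assms(2)] k(1) that by auto
    moreover have "w (x + k) t \<in> (\<lambda>(x,t). w x t) ` (closed_cell \<times> {0..R})"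
      by (rule image_eqI[of _ _ "(x + k, t)"]) (use k(2) unit_cell_subset that in auto)
    ultimately show ?thesis using M by force
  qed
  then show thesis by (rule that)
qed

text \<open>
  A one-sided comparison between a viscosity subsolution \<open>U\<close> of the first-order equation and a
  smooth supersolution \<open>V\<close> of the viscous one.  At a maximum of
  \<open>\<Phi>(x,y,t) = U(x,t) - V(y,t) - |x - y|\<^sup>2 / (2\<delta>) - \<theta>(t)\<close> at a positive time both equations are evaluated at
  the same \<open>p = (x - y)/\<delta>\<close>, which is the gradient of \<open>V\<close>, hence \<open>|p| \<le> C\<close> and \<open>|x - y| \<le> C \<delta>\<close>.
  Subtracting them bounds \<open>\<theta>'\<close> by \<open>\<epsilon> n/\<delta> + L C \<delta>\<close>, which a steeper \<open>\<theta>\<close> contradicts.  At time zero \<open>\<Phi>\<close> is at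
  most \<open>C\<^sup>2 \<delta>/2\<close>, the maximum of \<open>C r - r\<^sup>2/(2\<delta>)\<close>.  Time is not doubled, as \<open>V\<close> is differentiable in time.
\<close>

lemma doubling_comparison:
  fixes U V :: "real^'n \<Rightarrow> real \<Rightarrow> real" and F :: "real^'n \<Rightarrow> real^'n \<Rightarrow> real"
  assumes U_cont: "continuous_on (UNIV \<times> {0..}) (\<lambda>(x,t). U x t)"
    and U_per: "\<And>t. t \<ge> 0 \<Longrightarrow> periodic (\<lambda>x. U x t)"
    and sub: "\<And>\<phi> x t. \<lbrakk>C1_on (UNIV \<times> {0<..}) (\<lambda>(y,r). \<phi> y r); t > 0;
        \<forall>\<^sub>F (y,r) in nhds (x,t). U y r - \<phi> y r \<le> U x t - \<phi> x t\<rbrakk> \<Longrightarrow>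
        deriv (\<phi> x) t + F x (grad (\<lambda>y. \<phi> y t) x) \<le> 0"
    and V_cont: "continuous_on (UNIV \<times> {0..}) (\<lambda>(x,t). V x t)"
    and V_per: "\<And>t. t \<ge> 0 \<Longrightarrow> periodic (\<lambda>x. V x t)"
    and V_C21: "C21_on {0<..} V"
    and super: "\<And>x t. t > 0 \<Longrightarrow> deriv (V x) t + F x (grad (\<lambda>y. V y t) x) \<ge> \<epsilon> * laplacian (\<lambda>y. V y t) x"
    and V_grad: "\<And>x t. t > 0 \<Longrightarrow> norm (grad (\<lambda>y. V y t) x) \<le> C"
    and init: "\<And>x y. U x 0 - V y 0 \<le> C * norm (x - y)"
    and F_lip: "\<And>x y p. norm p \<le> C \<Longrightarrow> \<bar>F x p - F y p\<bar> \<le> L * norm (x - y)"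
    and pos: "\<epsilon> \<ge> 0" "\<delta> > 0" "T > 0" "C \<ge> 0" "L \<ge> 0"
  shows "U z T - V z T \<le> (\<epsilon> * real CARD('n) / \<delta> + L * C * \<delta>) * T + C\<^sup>2 * \<delta> / 2"
proof (rule ccontr)
  define \<kappa> where "\<kappa> = \<epsilon> * real CARD('n) / \<delta> + L * C * \<delta>"
  \<comment> \<open>The excess over the claimed bound is spent on making \<open>\<theta>\<close> slightly steeper than \<open>\<kappa>\<close> and on a
    barrier at the final time.\<close>
  define gap where "gap = U z T - V z T - \<kappa> * T - C\<^sup>2 * \<delta> / 2"
  assume "\<not> ?thesis"
  then have gap: "gap > 0" by (simp add: gap_def \<kappa>_def)
  have \<kappa>: "\<kappa> \<ge> 0" using pos by (simp add: \<kappa>_def)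
  define \<rho> where "\<rho> = \<kappa> + gap / (4 * T)"
  have \<rho>: "\<rho> > \<kappa>" "\<rho> * T = \<kappa> * T + gap / 4" using gap pos by (auto simp: \<rho>_def field_simps)
  obtain M1 where M1: "\<And>x t. t \<in> {0..2*T} \<Longrightarrow> \<bar>U x t\<bar> \<le> M1"
    using periodic_continuous_bounded[OF U_cont U_per] by blast
  obtain M2 where M2: "\<And>x t. t \<in> {0..2*T} \<Longrightarrow> \<bar>V x t\<bar> \<le> M2"
    using periodic_continuous_bounded[OF V_cont V_per] by blast
  define M where "M = M1 + M2"
  have M: "U x t - V y t \<le> M" if "t \<in> {0..2*T}" for x y t
    using M1[OF that, of x] M2[OF that, of y] by (auto simp: M_def)
  have M0: "M \<ge> 0" using M1[of 0 0] M2[of 0 0] pos by (auto simp: M_def)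
  obtain N where N: "M / (gap / 4) < 2 ^ N" using real_arch_pow[of 2] by auto
  \<comment> \<open>The test functions need a two-sided time neighbourhood, so the maximum is taken up to time
    \<open>2 * T\<close>; the power term keeps it away from that end and costs only \<open>gap / 4\<close> at \<open>T\<close>.\<close>
  define \<theta> where "\<theta> t = \<rho> * t + gap / 4 * (t / T) ^ N" for t
  define \<theta>' where "\<theta>' t = \<rho> + gap / 4 * (real N * (1 / T * (t / T) ^ (N - Suc 0)))" for t
  have \<theta>: "(\<theta> has_real_derivative \<theta>' t) (at t)" for t
    unfolding \<theta>_def \<theta>'_def using pos by (auto intro!: derivative_eq_intros)
  have \<theta>'_ge: "\<theta>' t \<ge> \<rho>" if "t \<ge> 0" for t using that gap pos by (simp add: \<theta>'_def)
  have \<theta>_nonneg: "\<theta> t \<ge> 0" if "t \<ge> 0" for t using that gap pos \<rho>(1) \<kappa> by (simp add: \<theta>_def)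
  have \<theta>_cont: "continuous_on S \<theta>" for S
    unfolding \<theta>_def by (intro continuous_intros) (use pos in auto)
  define \<Phi> where "\<Phi> x y t = U x t - V y t - (norm (x - y))\<^sup>2 / (2 * \<delta>) - \<theta> t" for x y t
  have \<Phi>_shift: "\<Phi> (x + k) (y + k) t = \<Phi> x y t" if "\<And>i. k $ i \<in> \<int>" "t \<ge> 0" for x y k t
    using periodic_shift[OF U_per] periodic_shift[OF V_per] that by (simp add: \<Phi>_def)
  have diag: "\<Phi> z z T = C\<^sup>2 * \<delta> / 2 + gap / 2"
  proof -
    have "\<theta> T = \<kappa> * T + gap / 2" using pos by (simp add: \<theta>_def \<rho>(2))
    moreover have "U z T - V z T = gap + \<kappa> * T + C\<^sup>2 * \<delta> / 2" by (simp add: gap_def)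
    ultimately show ?thesis by (simp add: \<Phi>_def)
  qed
  then have diag_pos: "\<Phi> z z T > 0" using gap pos by (simp add: add_nonneg_pos)
  \<comment> \<open>For \<open>|x - y| > R\<close> the penalty exceeds the bound \<open>M\<close>, so that maximising over \<open>|x - y| \<le> R\<close>,
    with \<open>x\<close> in the cell by periodicity, is maximising over everything.\<close>
  define R where "R = sqrt (2 * \<delta> * M)"
  have "0 \<le> 2 * \<delta> * M" using pos M0 by (intro mult_nonneg_nonneg) auto
  then have R: "0 \<le> R" "R\<^sup>2 = 2 * \<delta> * M" by (simp_all add: R_def)
  define K :: "((real^'n) \<times> (real^'n) \<times> real) set" where "K = closed_cell \<times> cball 0 R \<times> {0..2*T}"
  define \<Psi> where "\<Psi> = (\<lambda>(x,w,t). \<Phi> x (x + w) t)"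
  have "compact K" unfolding K_def by (intro compact_Times compact_cbox compact_cball compact_Icc)
  moreover have "K \<noteq> {}"
    unfolding K_def using pos R(1) by (auto simp: interval_ne_empty_cart)
  moreover have "continuous_on K \<Psi>"
    unfolding \<Psi>_def \<Phi>_def split_beta
    by (intro continuous_intros continuous_on_compose2[OF U_cont[unfolded split_beta], of _ "\<lambda>y. (fst y, snd (snd y))", simplified]
        continuous_on_compose2[OF V_cont[unfolded split_beta], of _ "\<lambda>y. (fst y + fst (snd y), snd (snd y))", simplified]
        continuous_on_compose2[OF \<theta>_cont[of UNIV]])
      (use pos in \<open>auto simp: K_def\<close>)
  ultimately obtain m where m: "m \<in> K" "\<And>y. y \<in> K \<Longrightarrow> \<Psi> y \<le> \<Psi> m"
    using continuous_attains_sup[of K \<Psi>] by metis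
  obtain x0 w0 t0 where m_eq: "m = (x0, w0, t0)" by (cases m)
  define y0 where "y0 = x0 + w0"
  have t0: "t0 \<in> {0..2*T}" using m(1) by (simp add: m_eq K_def)
  have near: "\<Phi> x y t \<le> \<Phi> x0 y0 t0" if "norm (y - x) \<le> R" "t \<in> {0..2*T}" for x y t
  proof -
    obtain k where k: "\<And>i. k $ i \<in> \<int>" "x + k \<in> unit_cell" using ex_shift_to_unit_cell[of x] by blast
    have "\<Psi> (x + k, y - x, t) \<le> \<Psi> m"
      by (rule m(2)) (use k(2) unit_cell_subset that in \<open>auto simp: K_def\<close>)
    moreover have "\<Psi> (x + k, y - x, t) = \<Phi> (x + k) (y + k) t" by (simp add: \<Psi>_def algebra_simps)
    ultimately show ?thesis using \<Phi>_shift[OF k(1)] that by (simp add: \<Psi>_def m_eq y0_def)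
  qed
  have val: "\<Phi> z z T \<le> \<Phi> x0 y0 t0" by (rule near) (use pos R(1) in auto)
  have max: "\<Phi> x y t \<le> \<Phi> x0 y0 t0" if t: "t \<in> {0..2*T}" for x y t
  proof (cases "norm (y - x) \<le> R")
    case False
    then have "R\<^sup>2 \<le> (norm (x - y))\<^sup>2"
      using R(1) by (intro power_mono) (auto simp: norm_minus_commute)
    then have "2 * \<delta> * M \<le> (norm (x - y))\<^sup>2" by (simp add: R(2))
    then have "M \<le> (norm (x - y))\<^sup>2 / (2 * \<delta>)" using pos by (simp add: field_simps)
    then have "\<Phi> x y t \<le> 0" using M[OF t, of x y] \<theta>_nonneg[of t] t by (auto simp: \<Phi>_def)
    then show ?thesis using val diag_pos by simp
  qed (use near t in auto)
  have "t0 \<noteq> 2 * T"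
  proof
    assume eq: "t0 = 2 * T"
    have "M \<le> gap / 4 * 2 ^ N" using N gap by (simp add: field_simps)
    moreover have "\<theta> t0 \<ge> gap / 4 * 2 ^ N" using pos \<rho>(1) \<kappa> by (simp add: \<theta>_def eq)
    moreover have "0 \<le> (norm (x0 - y0))\<^sup>2 / (2 * \<delta>)" using pos by simp
    ultimately have "\<Phi> x0 y0 t0 \<le> 0" using M[OF t0, of x0 y0] unfolding \<Phi>_def by linarith
    then show False using val diag_pos by simp
  qed
  moreover have "t0 \<noteq> 0"
  proof
    assume eq: "t0 = 0"
    have "0 \<le> (norm (x0 - y0) - C * \<delta>)\<^sup>2 / (2 * \<delta>)" using pos by simp
    also have "\<dots> = (norm (x0 - y0))\<^sup>2 / (2 * \<delta>) - C * norm (x0 - y0) + C\<^sup>2 * \<delta> / 2"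
      using pos by (simp add: power2_eq_square field_simps)
    finally have "\<Phi> x0 y0 t0 \<le> C\<^sup>2 * \<delta> / 2"
      using init[of x0 y0] \<theta>_nonneg[of 0] by (simp add: \<Phi>_def eq)
    then show False using val diag gap by simp
  qed
  ultimately have t0': "0 < t0" "t0 < 2 * T" using t0 by auto
  obtain D1 :: "real^'n \<Rightarrow> real \<Rightarrow> (real^'n) \<Rightarrow>\<^sub>L real"
    and D2 :: "real^'n \<Rightarrow> real \<Rightarrow> (real^'n) \<Rightarrow>\<^sub>L (real^'n) \<Rightarrow>\<^sub>L real"
    and Dt :: "real^'n \<Rightarrow> real \<Rightarrow> real"
    where D: "\<And>x t. t \<in> {0<..} \<Longrightarrow> ((\<lambda>y. V y t) has_derivative D1 x t) (at x)"
      "\<And>x t. t \<in> {0<..} \<Longrightarrow> ((\<lambda>y. D1 y t) has_derivative D2 x t) (at x)"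
      "\<And>x t. t \<in> {0<..} \<Longrightarrow> (V x has_real_derivative Dt x t) (at t)"
      and Dt_cont: "continuous_on (UNIV \<times> {0<..}) (\<lambda>(x,t). Dt x t)"
    by (rule C21_on_cases[OF V_C21]) (rule that)
  have t0I: "t0 \<in> {0<..}" using t0' by simp
  define p where "p = (1 / \<delta>) *\<^sub>R (x0 - y0)"
  have min: "V y0 t0 + (norm (x0 - y0))\<^sup>2 / (2 * \<delta>) \<le> V y t0 + (norm (x0 - y))\<^sup>2 / (2 * \<delta>)" for y
    using max[OF t0, of x0 y] by (simp add: \<Phi>_def)
  have gV: "grad (\<lambda>y. V y t0) y0 = p" and lV: "laplacian (\<lambda>y. V y t0) y0 \<ge> - real CARD('n) / \<delta>"
    unfolding p_def
    using derivatives_at_quadratic_touching[OF D(1)[OF t0I] D(2)[OF t0I] pos(2) min] by auto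
  have p: "norm p \<le> C" using V_grad[OF t0'(1), of y0] gV by simp
  have "x0 - y0 = \<delta> *\<^sub>R p" using pos by (simp add: p_def)
  then have xy: "norm (x0 - y0) \<le> C * \<delta>" using p pos by (simp add: mult.commute)
  define \<phi> where "\<phi> x t = (V y0 t + \<theta> t) + (norm (x - y0))\<^sup>2 / (2 * \<delta>)" for x t
  have "continuous_on {0<..} (Dt y0)"
    by (rule continuous_on_compose2[OF Dt_cont, of _ "\<lambda>t. (y0, t)", simplified]) (auto intro!: continuous_intros)
  moreover have "continuous_on {0<..} \<theta>'"
    unfolding \<theta>'_def by (intro continuous_intros) (use pos in auto)
  ultimately have ac: "continuous_on {0<..} (\<lambda>t. Dt y0 t + \<theta>' t)" by (intro continuous_intros)
  have a: "((\<lambda>t. V y0 t + \<theta> t) has_real_derivative Dt y0 t + \<theta>' t) (at t)" if "t > 0" for t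
    using D(3)[of t y0] that by (auto intro!: derivative_eq_intros \<theta>)
  have test: "C1_on (UNIV \<times> {0<..}) (\<lambda>(x,t). \<phi> x t)" "deriv (\<phi> x0) t0 = Dt y0 t0 + \<theta>' t0"
    "grad (\<lambda>x. \<phi> x t0) x0 = p"
    unfolding \<phi>_def[abs_def] p_def
    by (rule separated_test_function[OF a ac pos(2)]; use t0' in simp)+
  have "deriv (\<phi> x0) t0 + F x0 (grad (\<lambda>y. \<phi> y t0) x0) \<le> 0"
  proof (rule sub[OF test(1) t0'(1)])
    have "\<forall>\<^sub>F q in nhds (x0, t0). q \<in> UNIV \<times> {0<..<2*T}"
      by (rule eventually_nhds_in_open) (use t0' in \<open>auto intro: open_Times\<close>)
    then show "\<forall>\<^sub>F (y, r) in nhds (x0, t0). U y r - \<phi> y r \<le> U x0 t0 - \<phi> x0 t0"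
    proof eventually_elim
      case (elim q)
      then show ?case using max[of "snd q" "fst q" y0] by (auto simp: \<Phi>_def \<phi>_def)
    qed
  qed
  then have 1: "Dt y0 t0 + \<theta>' t0 + F x0 p \<le> 0" by (simp add: test)
  have "\<epsilon> * (- real CARD('n) / \<delta>) \<le> \<epsilon> * laplacian (\<lambda>y. V y t0) y0"
    by (intro mult_left_mono lV pos)
  also have "\<dots> \<le> Dt y0 t0 + F y0 p"
    using super[OF t0'(1), of y0] DERIV_imp_deriv[OF D(3)[OF t0I, of y0]] gV by simp
  finally have 2: "- (\<epsilon> * real CARD('n) / \<delta>) \<le> Dt y0 t0 + F y0 p" by simp
  have "\<bar>F x0 p - F y0 p\<bar> \<le> L * norm (x0 - y0)" by (rule F_lip[OF p])
  also have "\<dots> \<le> L * (C * \<delta>)" by (intro mult_left_mono xy pos)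
  finally have "\<theta>' t0 \<le> \<kappa>" using 1 2 by (simp add: \<kappa>_def mult.assoc)
  then show False using \<theta>'_ge[of t0] \<rho>(1) t0' by simp
qed

text \<open>
  The gradient bound is available for positive times only and passes to the limit \<open>t \<rightarrow> 0\<close> in
  its integrated form.
\<close>

lemma initial_datum_lipschitz:
  fixes v :: "real^'n \<Rightarrow> real \<Rightarrow> real"
  assumes v: "viscous_solution \<epsilon> H g v" and grad: "\<And>x t. t > 0 \<Longrightarrow> norm (grad (\<lambda>y. v y t) x) \<le> C"
  shows "\<bar>g x - g y\<bar> \<le> C * norm (x - y)"
proof -
  note vD = viscous_solutionD[OF v]
  have lim: "((\<lambda>t. v x t) \<longlongrightarrow> v x 0) (at_right 0)" for x
  proof -
    have "continuous_on {0..} (v x)"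
      by (rule continuous_on_compose2[OF vD(2), of _ "\<lambda>t. (x,t)", simplified]) (auto intro!: continuous_intros)
    then have "(v x \<longlongrightarrow> v x 0) (at 0 within {0..})" by (simp add: continuous_on)
    then show ?thesis by (rule tendsto_within_subset) auto
  qed
  have "\<bar>v x 0 - v y 0\<bar> \<le> C * norm (x - y)"
  proof (rule tendsto_upperbound)
    show "((\<lambda>t. \<bar>v x t - v y t\<bar>) \<longlongrightarrow> \<bar>v x 0 - v y 0\<bar>) (at_right 0)"
      by (intro tendsto_intros lim)
    show "\<forall>\<^sub>F t in at_right 0. \<bar>v x t - v y t\<bar> \<le> C * norm (x - y)"
    proof (rule eventually_at_right_less[THEN eventually_mono])
      fix t :: real assume t: "0 < t"
      obtain D1 :: "real^'n \<Rightarrow> real \<Rightarrow> (real^'n) \<Rightarrow>\<^sub>L real"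
        where D1: "\<And>x t. t \<in> {0<..} \<Longrightarrow> ((\<lambda>y. v y t) has_derivative D1 x t) (at x)"
        by (rule C21_on_cases[OF vD(3)]) (rule that)
      show "\<bar>v x t - v y t\<bar> \<le> C * norm (x - y)"
        by (rule lipschitz_in_space[OF D1 grad[OF t]]) (use t in simp)
    qed
  qed simp
  then show ?thesis by (simp add: vD(4))
qed

lemma test_function_uminus:
  fixes \<phi> :: "real^'n \<Rightarrow> real \<Rightarrow> real"
  assumes \<phi>: "C1_on (UNIV \<times> {0<..}) (\<lambda>(y,r). \<phi> y r)"
  shows "C1_on (UNIV \<times> {0<..}) (\<lambda>(y,r). - \<phi> y r)"
    and "t > 0 \<Longrightarrow> deriv (\<lambda>t. - \<phi> x t) t = - deriv (\<phi> x) t"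
    and "t > 0 \<Longrightarrow> grad (\<lambda>y. - \<phi> y t) x = - grad (\<lambda>y. \<phi> y t) x"
proof -
  obtain f' :: "(real^'n) \<times> real \<Rightarrow> ((real^'n) \<times> real) \<Rightarrow>\<^sub>L real"
    where f': "\<forall>y\<in>UNIV \<times> {0<..}. ((\<lambda>(y,r). \<phi> y r) has_derivative f' y) (at y)"
      and f'c: "continuous_on (UNIV \<times> {0<..}) f'"
    using \<phi> unfolding C1_on_def by blast
  have eq: "(\<lambda>(y,r). - \<phi> y r) = (\<lambda>q. - (\<lambda>(y,r). \<phi> y r) q)" by (simp add: fun_eq_iff)
  have "((\<lambda>(y,r). - \<phi> y r) has_derivative blinfun_apply (- f' y)) (at y)" if "y \<in> UNIV \<times> {0<..}" for y
    unfolding eq uminus_blinfun.rep_eq by (rule has_derivative_minus[OF bspec[OF f' that]])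
  then show "C1_on (UNIV \<times> {0<..}) (\<lambda>(y,r). - \<phi> y r)"
    unfolding C1_on_def
    by (intro exI[of _ "\<lambda>y. - f' y"] conjI ballI continuous_on_minus f'c)
  assume t: "t > 0"
  then have f'': "((\<lambda>(y,r). \<phi> y r) has_derivative f' (x,t)) (at (x,t))"
    using f' by simp
  have "((\<lambda>r. (\<lambda>(y,r). \<phi> y r) (x, r)) has_derivative (\<lambda>h. f' (x,t) (0, h))) (at t)"
    by (rule has_derivative_compose[of "\<lambda>r. (x, r)" "\<lambda>h. (0, h)" t UNIV "\<lambda>(y,r). \<phi> y r" "f' (x,t)"])
      (use f'' in \<open>auto intro!: derivative_eq_intros\<close>)
  moreover have "(\<lambda>h. f' (x,t) (0, h)) = (\<lambda>h. h * f' (x,t) (0, 1))"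
  proof
    fix h
    have "f' (x,t) (h *\<^sub>R (0, 1)) = h * f' (x,t) (0, 1)" by (simp add: blinfun.scaleR_right del: scaleR_Pair)
    then show "f' (x,t) (0, h) = h * f' (x,t) (0, 1)" by simp
  qed
  ultimately have "(\<phi> x has_real_derivative f' (x,t) (0, 1)) (at t)"
    by (simp add: has_field_derivative_def mult_commute_abs)
  then show "deriv (\<lambda>t. - \<phi> x t) t = - deriv (\<phi> x) t"
    by (metis DERIV_imp_deriv DERIV_minus)
  have "((\<lambda>y. (\<lambda>(y,r). \<phi> y r) (y, t)) has_derivative (\<lambda>h. f' (x,t) (h, 0))) (at x)"
    by (rule has_derivative_compose[of "\<lambda>y. (y, t)" "\<lambda>h. (h, 0)" x UNIV "\<lambda>(y,r). \<phi> y r" "f' (x,t)"])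
      (use f'' in \<open>auto intro!: derivative_eq_intros\<close>)
  then have dx: "((\<lambda>y. \<phi> y t) has_derivative (\<lambda>h. f' (x,t) (h, 0))) (at x)" by simp
  show "grad (\<lambda>y. - \<phi> y t) x = - grad (\<lambda>y. \<phi> y t) x"
    using has_derivative_imp_grad(1)[OF dx] has_derivative_imp_grad(1)[OF has_derivative_minus[OF dx]]
    by (simp add: vec_eq_iff)
qed

text \<open>
  The upper bound is the comparison for \<open>(u, v, H)\<close>.  The lower bound is the same comparison
  for \<open>(-u, -v)\<close> and the Hamiltonian \<open>-H(x,-p)\<close>, for which \<open>-u\<close> is a subsolution because \<open>u\<close> is a
  supersolution.
\<close>

lemma vanishing_viscosity_estimate:
  fixes H :: "real^'n \<Rightarrow> real^'n \<Rightarrow> real" and u v :: "real^'n \<Rightarrow> real \<Rightarrow> real"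
  assumes u: "viscosity_solution H g u" and v: "viscous_solution \<epsilon> H g v"
    and grad: "\<And>x t. t > 0 \<Longrightarrow> norm (grad (\<lambda>y. v y t) x) \<le> C"
    and H_lip: "\<And>x y p. norm p \<le> C \<Longrightarrow> \<bar>H x p - H y p\<bar> \<le> L * norm (x - y)"
    and pos: "\<epsilon> > 0" "T > 0" "C \<ge> 0" "L \<ge> 0"
  shows "\<bar>u z T - v z T\<bar> \<le> ((real CARD('n) + L * C) * T + C\<^sup>2 / 2) * sqrt \<epsilon>"
proof -
  let ?b = "(\<epsilon> * real CARD('n) / sqrt \<epsilon> + L * C * sqrt \<epsilon>) * T + C\<^sup>2 * sqrt \<epsilon> / 2"
  note vD = viscous_solutionD[OF v]
  have u_per: "periodic (\<lambda>x. u x t)" if "t \<ge> 0" for t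
    using u that by (simp add: viscosity_solution_def)
  have u_cont: "continuous_on (UNIV \<times> {0..}) (\<lambda>(x,t). u x t)" and u0: "u x 0 = g x" for x
    using u by (simp_all add: viscosity_solution_def)
  have u_sub: "deriv (\<phi> x) t + H x (grad (\<lambda>y. \<phi> y t) x) \<le> 0"
    if "C1_on (UNIV \<times> {0<..}) (\<lambda>(y,r). \<phi> y r)" "t > 0"
      "\<forall>\<^sub>F (y,r) in nhds (x,t). u y r - \<phi> y r \<le> u x t - \<phi> x t" for \<phi> x t
    using u that unfolding viscosity_solution_def by blast
  have u_super: "deriv (\<phi> x) t + H x (grad (\<lambda>y. \<phi> y t) x) \<ge> 0"
    if "C1_on (UNIV \<times> {0<..}) (\<lambda>(y,r). \<phi> y r)" "t > 0"
      "\<forall>\<^sub>F (y,r) in nhds (x,t). u y r - \<phi> y r \<ge> u x t - \<phi> x t" for \<phi> x t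
    using u that unfolding viscosity_solution_def by blast
  have init: "\<bar>g x - g y\<bar> \<le> C * norm (x - y)" for x y by (rule initial_datum_lipschitz[OF v grad])
  have sq: "sqrt \<epsilon> > 0" using pos by simp
  have "u z T - v z T \<le> ?b"
  proof (rule doubling_comparison[where F = H and U = u and V = v])
    show "u x 0 - v y 0 \<le> C * norm (x - y)" for x y
      using init[of x y] by (simp add: u0 vD(4))
  qed (use u_cont u_per u_sub vD grad H_lip pos sq in auto)
  moreover have "- u z T - - v z T \<le> ?b"
  proof (rule doubling_comparison[where F = "\<lambda>x p. - H x (- p)" and U = "\<lambda>x t. - u x t" and V = "\<lambda>x t. - v x t"])
    have neg: "C21_on {0<..} (\<lambda>x t. - v x t)"
      and neg_deriv: "\<And>x t. t > 0 \<Longrightarrow> deriv (\<lambda>t. - v x t) t = - deriv (v x) t"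
      and neg_grad: "\<And>x t. t > 0 \<Longrightarrow> grad (\<lambda>y. - v y t) x = - grad (\<lambda>y. v y t) x"
      and neg_lap: "\<And>x t. t > 0 \<Longrightarrow> laplacian (\<lambda>y. - v y t) x = - laplacian (\<lambda>y. v y t) x"
      using C21_on_time_mult[OF vD(3), of "\<lambda>_. -1" "\<lambda>_. 0"] by auto
    show "continuous_on (UNIV \<times> {0..}) (\<lambda>(x,t). - u x t)" "continuous_on (UNIV \<times> {0..}) (\<lambda>(x,t). - v x t)"
      using u_cont vD(2) by (auto simp: split_beta intro!: continuous_intros)
    show "periodic (\<lambda>x. - u x t)" "periodic (\<lambda>x. - v x t)" if "t \<ge> 0" for t
      using u_per[OF that] vD(1)[OF that] by (simp_all add: periodic_def)
    show "deriv (\<phi> x) t + - H x (- grad (\<lambda>y. \<phi> y t) x) \<le> 0"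
      if \<phi>: "C1_on (UNIV \<times> {0<..}) (\<lambda>(y,r). \<phi> y r)" and t: "t > 0"
        and max: "\<forall>\<^sub>F (y,r) in nhds (x,t). - u y r - \<phi> y r \<le> - u x t - \<phi> x t" for \<phi> x t
    proof -
      have "\<forall>\<^sub>F (y,r) in nhds (x,t). u y r - - \<phi> y r \<ge> u x t - - \<phi> x t"
        using max by eventually_elim auto
      then have "deriv (\<lambda>t. - \<phi> x t) t + H x (grad (\<lambda>y. - \<phi> y t) x) \<ge> 0"
        by (rule u_super[OF test_function_uminus(1)[OF \<phi>] t])
      then show ?thesis by (simp add: test_function_uminus(2,3)[OF \<phi> t])
    qed
    show "C21_on {0<..} (\<lambda>x t. - v x t)" by (rule neg)
    show "deriv (\<lambda>t. - v x t) t + - H x (- grad (\<lambda>y. - v y t) x) \<ge> \<epsilon> * laplacian (\<lambda>y. - v y t) x"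
      if "t > 0" for x t
      using vD(5)[OF that, of x] that by (simp add: neg_deriv neg_grad neg_lap)
    show "norm (grad (\<lambda>y. - v y t) x) \<le> C" if "t > 0" for x t
      using grad[OF that, of x] that by (simp add: neg_grad)
    show "- u x 0 - - v y 0 \<le> C * norm (x - y)" for x y
      using init[of x y] by (simp add: u0 vD(4))
    show "\<bar>- H x (- p) - - H y (- p)\<bar> \<le> L * norm (x - y)" if "norm p \<le> C" for x y p
      using H_lip[of "- p" x y] that by simp
  qed (use pos sq in auto)
  moreover have "?b = ((real CARD('n) + L * C) * T + C\<^sup>2 / 2) * sqrt \<epsilon>"
  proof -
    have "\<epsilon> * real CARD('n) / sqrt \<epsilon> = real CARD('n) * sqrt \<epsilon>"
      using pos real_div_sqrt[of \<epsilon>] by (simp add: field_simps)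
    then show ?thesis by (simp add: algebra_simps)
  qed
  ultimately show ?thesis by (simp add: abs_le_iff)
qed

section \<open>The representation formula and its limit\<close>

theorem theorem1p1:
  fixes H :: "real^'n \<Rightarrow> real^'n \<Rightarrow> real"
    and g :: "real^'n \<Rightarrow> real"
    and u :: "real^'n \<Rightarrow> real \<Rightarrow> real"
    and ue :: "real \<Rightarrow> real^'n \<Rightarrow> real \<Rightarrow> real"
    and C T :: real
    and z :: "real^'n"
    and \<sigma> :: "real \<Rightarrow> real^'n \<Rightarrow> real \<Rightarrow> real"
    and \<nu> :: "real \<Rightarrow> real \<Rightarrow> ((real^'n) \<times> (real^'n)) measure"
    and \<mu> :: "real \<Rightarrow> ((real^'n) \<times> (real^'n) \<times> real) measure"
  assumes H_C2: "C2_on UNIV (\<lambda>(x,p). H x p)"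
    and H_per: "\<And>p. periodic (\<lambda>x. H x p)"
    and g_C2: "C2_on UNIV g"
    and g_per: "periodic g"
    and A1: "filterlim (\<lambda>p. INF x. (H x p)\<^sup>2 / 2 + grad (\<lambda>y. H y p) x \<bullet> p) at_top at_infinity"
    and u: "viscosity_solution H g u"
    and ue: "\<And>\<epsilon>. \<epsilon> \<in> {0<..<1} \<Longrightarrow> viscous_solution \<epsilon> H g (ue \<epsilon>)"
    and C_pos: "C > 0"
    and C_bound: "\<And>\<epsilon> x t y s. \<epsilon> \<in> {0<..<1} \<Longrightarrow> t > 0 \<Longrightarrow> s > 0 \<Longrightarrow>
          \<bar>deriv (ue \<epsilon> x) t\<bar> + norm (grad (\<lambda>w. ue \<epsilon> w s) y) \<le> C"
    and T_pos: "T > 0"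
    and \<sigma>: "\<And>\<epsilon>. \<epsilon> \<in> {0<..<1} \<Longrightarrow> adjoint_solution \<epsilon> H (ue \<epsilon>) z T (\<sigma> \<epsilon>)"
    and \<sigma>_nonneg: "\<And>\<epsilon> x t. \<epsilon> \<in> {0<..<1} \<Longrightarrow> t \<in> {0..<T} \<Longrightarrow> \<sigma> \<epsilon> x t \<ge> 0"
    and \<nu>: "\<And>\<epsilon> t. \<epsilon> \<in> {0<..<1} \<Longrightarrow> t \<in> {0..<T} \<Longrightarrow>
          nu_measure C (grad (\<lambda>x. ue \<epsilon> x t)) (\<lambda>x. \<sigma> \<epsilon> x t) (\<nu> \<epsilon> t)"
    and \<mu>: "\<And>\<epsilon>. \<epsilon> \<in> {0<..<1} \<Longrightarrow> mu_measure C T (\<nu> \<epsilon>) (\<mu> \<epsilon>)"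
  shows "(\<forall>\<epsilon>\<in>{0<..<1}.
            ue \<epsilon> z T = (LINT x:unit_cell|lborel. g x * \<sigma> \<epsilon> x 0)
              + (LINT t:{0..T}|lborel. LINT (x,p)|\<nu> \<epsilon> t. grad (H x) p \<bullet> p - H x p)
          \<and> ue \<epsilon> z T = (LINT x:unit_cell|lborel. g x * \<sigma> \<epsilon> x 0)
              + (LINT (x,p,t)|\<mu> \<epsilon>. grad (H x) p \<bullet> p - H x p))
       \<and> (\<forall>(e :: nat \<Rightarrow> real) (\<sigma>z :: (real^'n) measure) (\<mu>z :: ((real^'n) \<times> (real^'n) \<times> real) measure).
            (\<forall>k. e k \<in> {0<..<1}) \<and> e \<longlonglongrightarrow> 0
          \<and> finite_borel_measure_on unit_cell \<sigma>z
          \<and> finite_borel_measure_on (unit_cell \<times> cball 0 C \<times> {0..T}) \<mu>z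
          \<and> (\<forall>\<phi> :: real^'n \<Rightarrow> real. continuous_on UNIV \<phi> \<and> periodic \<phi> \<longrightarrow>
               (\<lambda>k. LINT x:unit_cell|lborel. \<phi> x * \<sigma> (e k) x 0) \<longlonglongrightarrow> (LINT x|\<sigma>z. \<phi> x))
          \<and> (\<forall>\<psi> :: real^'n \<Rightarrow> real^'n \<Rightarrow> real \<Rightarrow> real.
               continuous_on UNIV (\<lambda>(x,p,t). \<psi> x p t) \<and> (\<forall>p t. periodic (\<lambda>x. \<psi> x p t)) \<longrightarrow>
               (\<lambda>k. LINT (x,p,t)|\<mu> (e k). \<psi> x p t) \<longlonglongrightarrow> (LINT (x,p,t)|\<mu>z. \<psi> x p t))
          \<longrightarrow> u z T = (LINT x|\<sigma>z. g x) + (LINT (x,p,t)|\<mu>z. grad (H x) p \<bullet> p - H x p))"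
proof -
  have grad_bound: "norm (grad (\<lambda>w. ue \<epsilon> w s) y) \<le> C" if "\<epsilon> \<in> {0<..<1}" "s > 0" for \<epsilon> s y
    using C_bound[OF that(1,2,2), of y y] by linarith
  have formula: "ue \<epsilon> z T = (LINT x:unit_cell|lborel. g x * \<sigma> \<epsilon> x 0)
              + (LINT t:{0..T}|lborel. LINT (x,p)|\<nu> \<epsilon> t. action_density H x p)"
    if \<epsilon>: "\<epsilon> \<in> {0<..<1}" for \<epsilon>
    by (rule duality_representation[OF H_C2 H_per ue[OF \<epsilon>] C_bound[OF \<epsilon>] T_pos \<sigma>[OF \<epsilon>]
        \<sigma>_nonneg[OF \<epsilon>] \<nu>[OF \<epsilon>]])
  have occupation: "(LINT (x,p,t)|\<mu> \<epsilon>. action_density H x p)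
      = (LINT t:{0..T}|lborel. LINT (x,p)|\<nu> \<epsilon> t. action_density H x p)"
    if \<epsilon>: "\<epsilon> \<in> {0<..<1}" for \<epsilon>
    by (rule occupation_integral[OF \<mu>[OF \<epsilon>] \<nu>[OF \<epsilon>] continuous_on_action_density[OF H_C2]
        continuous_on_nu_integral[OF viscous_solutionD(3)[OF ue[OF \<epsilon>]]
          adjoint_solutionD(2)[OF \<sigma>[OF \<epsilon>]] continuous_on_action_density[OF H_C2]
          periodic_action_density[OF H_per] \<nu>[OF \<epsilon>]]])
  show ?thesis
    unfolding action_density_def[symmetric]
  proof (intro conjI ballI allI impI; (elim conjE)?)
    fix \<epsilon> :: real assume \<epsilon>: "\<epsilon> \<in> {0<..<1}"
    show "ue \<epsilon> z T = (LINT x:unit_cell|lborel. g x * \<sigma> \<epsilon> x 0)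
              + (LINT t:{0..T}|lborel. LINT (x,p)|\<nu> \<epsilon> t. action_density H x p)"
      by (rule formula[OF \<epsilon>])
    show "ue \<epsilon> z T = (LINT x:unit_cell|lborel. g x * \<sigma> \<epsilon> x 0)
              + (LINT (x,p,t)|\<mu> \<epsilon>. action_density H x p)"
      unfolding occupation[OF \<epsilon>] by (rule formula[OF \<epsilon>])
  next
    fix e :: "nat \<Rightarrow> real" and \<sigma>z :: "(real^'n) measure"
      and \<mu>z :: "((real^'n) \<times> (real^'n) \<times> real) measure"
    assume e: "\<forall>k. e k \<in> {0<..<1}" and e0: "e \<longlonglongrightarrow> 0"
      and \<sigma>z: "\<forall>\<phi> :: real^'n \<Rightarrow> real. continuous_on UNIV \<phi> \<and> periodic \<phi> \<longrightarrow>
               (\<lambda>k. LINT x:unit_cell|lborel. \<phi> x * \<sigma> (e k) x 0) \<longlonglongrightarrow> (LINT x|\<sigma>z. \<phi> x)"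
      and \<mu>z: "\<forall>\<psi> :: real^'n \<Rightarrow> real^'n \<Rightarrow> real \<Rightarrow> real.
               continuous_on UNIV (\<lambda>(x,p,t). \<psi> x p t) \<and> (\<forall>p t. periodic (\<lambda>x. \<psi> x p t)) \<longrightarrow>
               (\<lambda>k. LINT (x,p,t)|\<mu> (e k). \<psi> x p t) \<longlonglongrightarrow> (LINT (x,p,t)|\<mu>z. \<psi> x p t)"
    have e_in: "e k \<in> {0<..<1}" for k using e by blast
    obtain L where L: "L \<ge> 0"
      "\<And>x y p. norm p \<le> C \<Longrightarrow> \<bar>H x p - H y p\<bar> \<le> L * norm (x - y)"
      using lipschitz_in_position[OF H_C2 H_per, of C] by blast
    have "(\<lambda>k. u z T - ue (e k) z T) \<longlonglongrightarrow> 0"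
    proof (rule Lim_null_comparison)
      show "\<forall>\<^sub>F k in sequentially. norm (u z T - ue (e k) z T)
          \<le> ((real CARD('n) + L * C) * T + C\<^sup>2 / 2) * sqrt (e k)"
        unfolding real_norm_def
        by (intro always_eventually allI
            vanishing_viscosity_estimate[OF u ue[OF e_in] grad_bound[OF e_in] L(2)])
          (use e_in T_pos C_pos L(1) in auto)
      have "(\<lambda>k. sqrt (e k)) \<longlonglongrightarrow> 0" using tendsto_real_sqrt[OF e0] by (simp only: real_sqrt_zero)
      then show "(\<lambda>k. ((real CARD('n) + L * C) * T + C\<^sup>2 / 2) * sqrt (e k)) \<longlonglongrightarrow> 0"
        by (rule tendsto_mult_right_zero)
    qed
    from tendsto_diff[OF tendsto_const[of "u z T"] this]
    have 1: "(\<lambda>k. ue (e k) z T) \<longlonglongrightarrow> u z T" by simp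
    have "continuous_on UNIV g"
      using C2_on_imp_C1[OF g_C2] has_derivative_continuous
      by (metis continuous_at_imp_continuous_on)
    then have 2: "(\<lambda>k. LINT x:unit_cell|lborel. g x * \<sigma> (e k) x 0) \<longlonglongrightarrow> (LINT x|\<sigma>z. g x)"
      using \<sigma>z g_per by blast
    have "continuous_on UNIV (\<lambda>(x,p,t :: real). action_density H x p)"
      unfolding split_beta
      by (rule continuous_on_compose2[OF continuous_on_action_density[OF H_C2, unfolded split_beta],
            of _ "\<lambda>y. (fst y, fst (snd y))", simplified]) (intro continuous_intros)
    then have 3: "(\<lambda>k. LINT (x,p,t)|\<mu> (e k). action_density H x p)
        \<longlonglongrightarrow> (LINT (x,p,t)|\<mu>z. action_density H x p)"
      using \<mu>z[THEN spec, of "\<lambda>x p t. action_density H x p"] periodic_action_density[of H, OF H_per] by blast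
    have "(\<lambda>k. ue (e k) z T) = (\<lambda>k. (LINT x:unit_cell|lborel. g x * \<sigma> (e k) x 0)
        + (LINT (x,p,t)|\<mu> (e k). action_density H x p))"
      by (intro ext) (simp add: occupation[OF e_in] formula[OF e_in])
    with 1 have "(\<lambda>k. (LINT x:unit_cell|lborel. g x * \<sigma> (e k) x 0)
        + (LINT (x,p,t)|\<mu> (e k). action_density H x p)) \<longlonglongrightarrow> u z T" by simp
    from LIMSEQ_unique[OF this tendsto_add[OF 2 3]]
    show "u z T = (LINT x|\<sigma>z. g x) + (LINT (x,p,t)|\<mu>z. action_density H x p)" .
  qed
qed

end
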